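(* Let $Q\subset\mathbb{R}^2$ be a convex polygon. For the dynamical system $\dot P=-\operatorname{Ln}(\partial\mathcal{H}_{\mathrm{DC}})(P)$ (respectively, $\dot P=\operatorname{Ln}(\partial\mathcal{H}_{\mathrm{SP}})(P)$) on $Q^n$, with solutions understood in the Filippov sense, the generators' location $P=(p_1,\dots,p_n)$ converges asymptotically (as $t\to+\infty$) to the set of critical points of $\mathcal{H}_{\mathrm{DC}}$ (respectively, of $\mathcal{H}_{\mathrm{SP}}$).
   Context: $\|\cdot\|$ is the Euclidean norm, $\operatorname{Ed}(Q)$ is the set of edges of $Q$, and $\operatorname{D}_e(p)$ is the distance from $p$ to $e$. For $P=(p_1,\dots,p_n)\in Q^n$, $\mathcal{H}_{\mathrm{DC}}(P)=\max_{q\in Q}\min_{i\in\{1,\dots,n\}}\|q-p_i\|$ and $\mathcal{H}_{\mathrm{SP}}(P)=\min\{\tfrac12\|p_i-p_j\|,\ \operatorname{D}_e(p_i) : i,j\in\{1,\dots,n\},\ i\ne j,\ e\in\operatorname{Ed}(Q)\}$. For a locally Lipschitz function $f$, the (Clarke) generalized gradient is $\partial f(x)=\operatorname{co}\{\lim_{i\to\infty}df(x_i) : x_i\to x,\ x_i\notin S\cup\Omega_f\}$, where $\Omega_f$ is the set of points where $f$ is not differentiable, $S$ is any set of measure zero, and $\operatorname{co}$ is the convex hull. A point $x$ is a critical point of $f$ if $0\in\partial f(x)$. For a closed convex set $S$, $\operatorname{Ln}(S)$ is its least-norm element, and $\operatorname{Ln}(\partial f)(x)=\operatorname{Ln}(\partial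 f(x))$. A Filippov solution of $\dot x=X(x)$ is an absolutely continuous curve with $\dot x(t)\in K[X](x(t))$ for almost all $t$, where $K[X]$ is the Filippov set-valued map of $X$. The dynamical systems are considered on the compact set $Q^n$, i.e., with initial conditions in $Q^n$ (the paper notes that $Q^n$ is strongly invariant for both). *)

theory Defs
  imports "HOL-Analysis.Analysis"
begin

text \<open>The number of generators is \<open>n = CARD('n)\<close>; a configuration \<open>(p\<^sub>1, \<dots>, p\<^sub>n)\<close> is a point of
  the Euclidean space \<open>(real^2)^'n\<close>.\<close>

definition convex_polygon :: "(real^2) set \<Rightarrow> bool" where
  "convex_polygon Q \<longleftrightarrow> polytope Q \<and> aff_dim Q = 2"

definition configurations :: "(real^2) set \<Rightarrow> ((real^2)^'n) set" where
  "configurations Q = {P. \<forall>i. P $ i \<in> Q}"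

text \<open>The supremum is a maximum when \<open>Q\<close> is compact and nonempty.\<close>

definition H_DC :: "(real^2) set \<Rightarrow> (real^2)^'n \<Rightarrow> real" where
  "H_DC Q P = (SUP q\<in>Q. MIN i. norm (q - P $ i))"

text \<open>The condition \<open>i \<noteq> j\<close> concerns only the pairwise distances, so that for one generator the
  distances to the edges remain. The set below is finite because a polytope has finitely many
  faces.\<close>

definition H_SP :: "(real^2) set \<Rightarrow> (real^2)^'n \<Rightarrow> real" where
  "H_SP Q P = Min ({norm (P $ i - P $ j) / 2 | i j. i \<noteq> j} \<union> {infdist (P $ i) e | i e. e edge_of Q})"

text \<open>Clarke's generalized gradient of a function \<open>f\<close> with domain \<open>D\<close>, with the null set \<open>S\<close> of its
  definition kept as a parameter. Points outside the interior of \<open>D\<close> count as points where \<open>f\<close> is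
  not differentiable, so the values of \<open>f\<close> outside \<open>D\<close> play no role; for \<open>x\<close> in the interior of
  \<open>D\<close> the restriction to \<open>D\<close> has no effect.\<close>

definition generalized_gradient ::
    "'a::euclidean_space set \<Rightarrow> 'a set \<Rightarrow> ('a \<Rightarrow> real) \<Rightarrow> 'a \<Rightarrow> 'a set" where
  "generalized_gradient S D f x =
     convex hull {v. \<exists>y g. (\<forall>k::nat. y k \<in> interior D - S \<and> GDERIV f (y k) :> g k) \<and>
                           y \<longlonglongrightarrow> x \<and> g \<longlonglongrightarrow> v}"

definition critical_points ::
    "'a::euclidean_space set \<Rightarrow> 'a set \<Rightarrow> ('a \<Rightarrow> real) \<Rightarrow> 'a set" where
  "critical_points S D f = {x \<in> D. 0 \<in> generalized_gradient S D f x}"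

definition least_norm :: "'a::euclidean_space set \<Rightarrow> 'a" where
  "least_norm C = arg_min_on norm C"

text \<open>The Filippov set-valued map of a vector field \<open>X\<close> with domain \<open>D\<close>.\<close>

definition filippov_map ::
    "'a::euclidean_space set \<Rightarrow> ('a \<Rightarrow> 'a) \<Rightarrow> 'a \<Rightarrow> 'a set" where
  "filippov_map D X x =
     (\<Inter>\<delta>\<in>{0<..}. \<Inter>N\<in>{N. negligible N}. closure (convex hull (X ` ((ball x \<delta> \<inter> D) - N))))"

text \<open>A division is a finite family of nonoverlapping closed intervals, here with endpoints
  \<open>Inf k\<close> and \<open>Sup k\<close>.\<close>

definition absolutely_continuous_curve :: "real set \<Rightarrow> (real \<Rightarrow> 'a::real_normed_vector) \<Rightarrow> bool" where
  "absolutely_continuous_curve I c \<longleftrightarrow>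
     (\<forall>\<epsilon>>0. \<exists>\<delta>>0. \<forall>d T. d division_of T \<and> T \<subseteq> I \<and> (\<Sum>k\<in>d. Sup k - Inf k) < \<delta> \<longrightarrow>
        (\<Sum>k\<in>d. norm (c (Sup k) - c (Inf k))) < \<epsilon>)"

text \<open>Filippov solutions on \<open>[0, \<infinity>)\<close>; the values of \<open>c\<close> at negative times are irrelevant. Absolute
  continuity on the unbounded time axis means absolute continuity on every compact interval.\<close>

definition filippov_solution ::
    "'a::euclidean_space set \<Rightarrow> ('a \<Rightarrow> 'a) \<Rightarrow> (real \<Rightarrow> 'a) \<Rightarrow> bool" where
  "filippov_solution D X c \<longleftrightarrow>
     (\<forall>T\<ge>0. absolutely_continuous_curve {0..T} c) \<and>
     (AE t in lebesgue. 0 \<le> t \<longrightarrow>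
        (\<exists>v. (c has_vector_derivative v) (at t) \<and> v \<in> filippov_map D X (c t)))"

text \<open>Not stated with \<open>infdist\<close>, since \<open>infdist x {} = 0\<close>.\<close>

definition converges_to_set :: "(real \<Rightarrow> 'a::metric_space) \<Rightarrow> 'a set \<Rightarrow> bool" where
  "converges_to_set c A \<longleftrightarrow> (\<forall>\<epsilon>>0. \<forall>\<^sub>F t in at_top. \<exists>a\<in>A. dist (c t) a < \<epsilon>)"

end

theory Submission
  imports Defs
begin

text \<open>The two functions are in general not regular in the sense of Clarke, but the
  domain is covered by finitely many compact pieces such that every gradient of the function \<open>f\<close> is a
  subgradient of the restriction of \<open>f\<close> to one of the pieces containing the point: for \<open>H_SP\<close>, a minimum of finitely many convex functions, the pieces are given
  by the active function; for \<open>H_DC\<close>, by the active generators together with the face of \<open>Q\<close>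
  containing the farthest point. Two subgradients \<open>z\<close>, \<open>w\<close> that persist on a common set force this
  set into thin cones around the hyperplane orthogonal to \<open>z - w\<close>. Hence the subgradient is unique,
  and \<open>f\<close> differentiable, outside a null set, and along a curve \<open>P\<close> the product \<open>z \<bullet> P' t\<close> is
  independent of the choice of \<open>z\<close> for all but countably many \<open>t\<close>. This gives the chain rule
  \<open>(f \<circ> P)' = \<plusminus> \<bar>P'\<bar>\<^sup>2\<close> along solutions. Away from the critical points the generalized gradient is
  bounded away from zero by compactness, and solutions are Lipschitz, so infinitely many excursions
  away from the critical points would contradict the boundedness of \<open>f\<close>.\<close>

text \<open>The obstacle is that a solution may stay inside the null set on which \<open>f\<close>
  is not differentiable, for instance on the frontier of the domain, so that almost-everywhere
  differentiability says nothing along it. The cone argument is therefore made twice with the same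
  sets \<open>near_pair\<close>: in space it gives a null set of points, in time a countable set of
  times, because at an accumulation time the velocity itself satisfies the cone inequality. The
  spatial version makes Clarke's gradient nonempty almost everywhere, so that
  \<open>least_norm\<close> is a genuine element there; the temporal version permits the chain rule.
  Compactness of the graphs carries statements about gradients in the interior over to their limits,
  up to the frontier. The factor \<open>\<sigma>\<close> with \<open>\<sigma> * \<sigma> = 1\<close>
  treats descent and ascent at once.\<close>

section \<open>Null sets and absolutely continuous curves\<close>

text \<open>The orthogonal projection of \<open>S\<close> along \<open>w\<close> has a Lipschitz inverse, so \<open>S\<close> is a Lipschitz
  image of a subset of a hyperplane.\<close>

lemma negligible_thin_cone:
  fixes w :: "'a::euclidean_space"
  assumes c: "0 \<le> c" "c < norm w"
    and thin: "\<And>x y. x \<in> S \<Longrightarrow> y \<in> S \<Longrightarrow> \<bar>w \<bullet> (y - x)\<bar> \<le> c * norm (y - x)"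
  shows "negligible S"
proof -
  have w: "w \<bullet> w > 0" using c by (metis inner_gt_zero_iff norm_zero linorder_not_less)
  define p where "p x = x - ((w \<bullet> x) / (w \<bullet> w)) *\<^sub>R w" for x
  \<comment> \<open>By Pythagoras: thinness bounds the component of a difference along
    \<open>w\<close> by \<open>c / norm w\<close> times its length, so the projection keeps at least
    the fraction \<open>k\<close> of the length.\<close>
  define k where "k = sqrt (1 - c\<^sup>2 / (w \<bullet> w))"
  have "c\<^sup>2 < w \<bullet> w" using c by (metis power2_norm_eq_inner power_strict_mono zero_less_numeral)
  then have k: "k > 0" using w by (simp add: k_def)
  have est: "k * norm (y - x) \<le> norm (p y - p x)" if "x \<in> S" "y \<in> S" for x y
  proof -
    let ?d = "y - x"
    have pd: "p y - p x = p ?d" by (simp add: p_def algebra_simps diff_divide_distrib)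
    have "(norm (p z))\<^sup>2 = z \<bullet> z - (w \<bullet> z)\<^sup>2 / (w \<bullet> w)" for z
      unfolding power2_norm_eq_inner p_def using w
      by (simp add: inner_diff_left inner_diff_right inner_commute[of z w] power2_eq_square)
    from this[of ?d] have "(norm (p ?d))\<^sup>2 = ?d \<bullet> ?d - (w \<bullet> ?d)\<^sup>2 / (w \<bullet> w)" .
    moreover have "(w \<bullet> ?d)\<^sup>2 \<le> c\<^sup>2 * (?d \<bullet> ?d)"
      using power_mono[OF thin[OF that], of 2] by (simp add: power_mult_distrib power2_norm_eq_inner)
    then have "(w \<bullet> ?d)\<^sup>2 / (w \<bullet> w) \<le> c\<^sup>2 * (?d \<bullet> ?d) / (w \<bullet> w)"
      using w by (simp add: divide_right_mono)
    moreover have "k\<^sup>2 = 1 - c\<^sup>2 / (w \<bullet> w)" using w \<open>c\<^sup>2 < w \<bullet> w\<close> by (simp add: k_def)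
    moreover have "(k * norm ?d)\<^sup>2 = k\<^sup>2 * (?d \<bullet> ?d)"
      by (simp only: power_mult_distrib power2_norm_eq_inner)
    ultimately have "(k * norm ?d)\<^sup>2 \<le> (norm (p ?d))\<^sup>2"
      by (simp only: left_diff_distrib) simp
    then show ?thesis unfolding pd by (meson norm_ge_zero power2_le_imp_le)
  qed
  then have inj: "inj_on p S"
  proof (intro inj_onI)
    fix x y assume "x \<in> S" "y \<in> S" "p x = p y"
    then have "k * norm (y - x) \<le> 0" using est[of x y] by simp
    then show "x = y" using k by (simp add: mult_le_0_iff)
  qed
  have "p x \<in> {y. w \<bullet> y = 0}" for x
    using w by (simp add: p_def inner_diff_right)
  then have "negligible (p ` S)"
    using negligible_hyperplane[of w 0] w by (auto elim!: negligible_subset)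
  moreover have "\<exists>T B. open T \<and> z \<in> T \<and> (\<forall>y\<in>p ` S \<inter> T. norm (inv_into S p y - inv_into S p z) \<le> B * norm (y - z))"
    if "z \<in> p ` S" for z
  proof (intro exI conjI ballI)
    fix y assume "y \<in> p ` S \<inter> UNIV"
    then show "norm (inv_into S p y - inv_into S p z) \<le> (1 / k) * norm (y - z)"
      using est[of "inv_into S p z" "inv_into S p y"] that k
      by (simp add: inv_into_into f_inv_into_f field_simps)
  qed auto
  ultimately have "negligible (inv_into S p ` p ` S)"
    using negligible_locally_Lipschitz_image[of "p ` S" "inv_into S p"] by blast
  then show ?thesis using inj by simp
qed

text \<open>A basic open set that meets \<open>T\<close> in a single point determines that point, so
  the isolated points inject into a countable basis. This is applied to sets of times: all but
  countably many of their elements are accumulation points.\<close>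

lemma countable_isolated_points:
  fixes T :: "'a::second_countable_topology set"
  shows "countable {x \<in> T. \<not> x islimpt T}"
proof -
  obtain B :: "'a set set" where B: "countable B" "topological_basis B"
    using ex_countable_basis by blast
  define I where "I = {x \<in> T. \<not> x islimpt T}"
  have "\<exists>U\<in>B. U \<inter> T = {x}" if "x \<in> I" for x
  proof -
    have "\<not> x islimpt T" "x \<in> T" using that by (simp_all add: I_def)
    from this(1) obtain V where V: "x \<in> V" "open V" "\<And>y. \<lbrakk>y \<in> T; y \<in> V\<rbrakk> \<Longrightarrow> y = x"
      unfolding islimpt_def by metis
    obtain U where "U \<in> B" "x \<in> U" "U \<subseteq> V"
      using topological_basisE[OF B(2) V(2,1)] by metis
    then have "U \<inter> T = {x}" using V(3) \<open>x \<in> T\<close> by auto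
    with \<open>U \<in> B\<close> show ?thesis by blast
  qed
  then obtain U where U: "U x \<in> B" "U x \<inter> T = {x}" if "x \<in> I" for x by metis
  then have "inj_on U I" by (intro inj_onI) (metis singleton_inject)
  moreover have "countable (U ` I)" using U B by (auto intro: countable_subset)
  ultimately show ?thesis unfolding I_def[symmetric] by (rule countable_image_inj_on[rotated])
qed

text \<open>Takes the place of the fundamental theorem of calculus for absolutely continuous
  functions. As only a one-sided bound on the derivative enters, no integral of the derivative has
  to be formed.\<close>

lemma absolutely_continuous_growth:
  fixes g :: "real \<Rightarrow> real"
  assumes ac: "absolutely_continuous_curve {a..b} g" and ab: "a \<le> b" and N: "negligible N"
    and der: "\<And>t. t \<in> {a..b} - N \<Longrightarrow> \<exists>d\<le>m. (g has_real_derivative d) (at t within {a..b})"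
  shows "g b - g a \<le> m * (b - a)"
proof -
  \<comment> \<open>In a fine tagged division, the intervals with tag in \<open>N\<close> have small total length and are
    controlled by absolute continuity, the other ones by the derivative at their tag.\<close>
  have main: "g b - g a \<le> (m + e) * (b - a) + 2 * e" if e: "e > 0" for e
  proof -
    obtain \<delta> where \<delta>: "\<delta> > 0"
      and ac\<delta>: "\<And>d T. d division_of T \<Longrightarrow> T \<subseteq> {a..b} \<Longrightarrow> (\<Sum>k\<in>d. Sup k - Inf k) < \<delta>
        \<Longrightarrow> (\<Sum>k\<in>d. norm (g (Sup k) - g (Inf k))) < e"
      using ac e unfolding absolutely_continuous_curve_def by metis
    \<comment> \<open>The second bound ensures that replacing the length of all intervals by the
      length of those with tag outside \<open>N\<close> changes the estimate by at most
      \<open>e\<close>.\<close>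
    define \<eta> where "\<eta> = min \<delta> (e / (\<bar>m + e\<bar> + 1))"
    have \<eta>: "\<eta> > 0" "\<eta> \<le> \<delta>" "\<bar>m + e\<bar> * \<eta> \<le> e"
    proof -
      have "\<bar>m + e\<bar> * \<eta> \<le> \<bar>m + e\<bar> * (e / (\<bar>m + e\<bar> + 1))"
        by (intro mult_left_mono) (auto simp: \<eta>_def)
      also have "\<dots> \<le> e" using e by (simp add: field_simps)
      finally show "\<bar>m + e\<bar> * \<eta> \<le> e" .
    qed (use \<delta> e in \<open>auto simp: \<eta>_def\<close>)
    have N': "N \<in> sets lebesgue" "N \<in> null_sets lebesgue"
      using N by (auto simp: negligible_imp_sets negligible_iff_null_sets)
    obtain U where U: "open U" "N \<subseteq> U" "(U - N) \<in> lmeasurable" "emeasure lebesgue (U - N) < ennreal \<eta>"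
      using sets_lebesgue_outer_open[OF N'(1) \<eta>(1)] by metis
    have Um: "U \<in> lmeasurable"
      using fmeasurable.Un[OF U(3) fmeasurableI_null_sets[OF N'(2)]] U(2) by (simp add: Un_absorb2)
    have "measure lebesgue U = measure lebesgue (U - N)"
      using measure_Diff_null_set[OF _ N'(2), of U] Um by auto
    also have "\<dots> < \<eta>" using U(3,4) \<eta> by (simp add: emeasure_eq_measure2 ennreal_less_iff)
    finally have mU: "measure lebesgue U < \<eta>" .
    \<comment> \<open>A straddle estimate: since \<open>t\<close> lies between \<open>u\<close> and
      \<open>v\<close>, the errors \<open>e * (v - t)\<close> and \<open>e * (t - u)\<close> add up
      to \<open>e * (v - u)\<close>.\<close>
    have "\<exists>r>0. (t \<in> N \<longrightarrow> ball t r \<subseteq> U) \<and>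
       (t \<in> {a..b} - N \<longrightarrow> (\<forall>u\<in>{a..t}. \<forall>v\<in>{t..b}. u \<in> ball t r \<and> v \<in> ball t r \<longrightarrow> g v - g u \<le> (m + e) * (v - u)))" for t
    proof (cases "t \<in> {a..b} - N")
      case True
      then obtain d where d: "d \<le> m" "(g has_real_derivative d) (at t within {a..b})" using der by blast
      then have "(g has_derivative (\<lambda>h. d * h)) (at t within {a..b})"
        by (simp add: has_field_derivative_def)
      then obtain r where r: "r > 0" "\<And>s. s \<in> {a..b} \<Longrightarrow> norm (s - t) < r \<Longrightarrow>
           norm (g s - g t - d * (s - t)) \<le> e * norm (s - t)"
        unfolding has_derivative_within_alt using e by metis
      have "g v - g u \<le> (m + e) * (v - u)" if "u \<in> {a..t}" "v \<in> {t..b}" "u \<in> ball t r" "v \<in> ball t r" for u v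
      proof -
        have "g v - g t - d * (v - t) \<le> e * (v - t)"
          using r(2)[of v] that True by (auto simp: dist_real_def abs_le_iff)
        moreover have "-(g u - g t - d * (u - t)) \<le> e * (t - u)"
          using r(2)[of u] that True by (auto simp: dist_real_def abs_le_iff)
        ultimately have "g v - g u \<le> (d + e) * (v - u)" by (simp add: algebra_simps)
        also have "\<dots> \<le> (m + e) * (v - u)" using d that by (intro mult_right_mono) auto
        finally show ?thesis .
      qed
      then show ?thesis using True r(1) by blast
    next
      case False
      then show ?thesis
        using U(1,2) by (cases "t \<in> N") (auto intro: exI[of _ 1] dest!: open_contains_ball[THEN iffD1])
    qed
    then obtain r where r0: "\<And>t. r t > 0" and rN: "\<And>t. t \<in> N \<Longrightarrow> ball t (r t) \<subseteq> U"
      and rD: "\<And>t u v. t \<in> {a..b} - N \<Longrightarrow> u \<in> {a..t} \<Longrightarrow> v \<in> {t..b} \<Longrightarrow> u \<in> ball t (r t)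
         \<Longrightarrow> v \<in> ball t (r t) \<Longrightarrow> g v - g u \<le> (m + e) * (v - u)"
      by metis
    have "gauge (\<lambda>t. ball t (r t))" using r0 by (auto simp: gauge_def)
    then obtain p where p: "p tagged_division_of {a..b}" "(\<lambda>t. ball t (r t)) fine p"
      using fine_division_exists_real by metis
    have finp: "finite p" using p by blast
    define p1 where "p1 = {(x,k) \<in> p. x \<in> N}"
    define p2 where "p2 = {(x,k) \<in> p. x \<notin> N}"
    have pp: "p = p1 \<union> p2" "p1 \<inter> p2 = {}" "finite p1" "finite p2" "p1 \<subseteq> p"
      using finp by (auto simp: p1_def p2_def intro: rev_finite_subset)
    have iv: "\<exists>u v. k = {u..v} \<and> u \<le> v \<and> x \<in> {u..v} \<and> {u..v} \<subseteq> {a..b} \<and> {u..v} \<subseteq> ball x (r x)" if "(x,k) \<in> p" for x k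
    proof -
      have xk: "x \<in> k" "k \<subseteq> {a..b}" "k \<subseteq> ball x (r x)" "\<exists>u v. k = cbox u v"
        using p that tagged_division_ofD(2-4)[OF p(1)] by (auto simp: fine_def)
      then show ?thesis by (auto simp: cbox_interval) 
    qed
    have p1: "(\<Sum>(x,k)\<in>p1. g (Sup k) - g (Inf k)) \<le> e" "\<bar>\<Sum>(x,k)\<in>p1. Sup k - Inf k\<bar> < \<eta>"
    proof -
      have tp: "p1 tagged_partial_division_of {a..b}"
        using p pp(5) tagged_division_of_def tagged_partial_division_subset by metis
      have tp': "p1 tagged_division_of (\<Union>(snd ` p1))"
        using tagged_partial_division_of_Union_self[OF tp] .
      have sum_snd: "(\<Sum>(x,k)\<in>p1. h (Inf k) (Sup k)) = (\<Sum>k\<in>snd ` p1. h (Inf k) (Sup k))"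
        if "\<And>u. h u u = 0" for h :: "real \<Rightarrow> real \<Rightarrow> real"
      proof -
        \<comment> \<open>The guard covers the empty interval, on which \<open>Inf\<close> and
          \<open>Sup\<close> are mere default values.\<close>
        have *: "(\<Sum>(x,k)\<in>p1. (if k = {} then 0 else h (Inf k) (Sup k)))
            = (\<Sum>k\<in>snd ` p1. (if k = {} then 0 else h (Inf k) (Sup k)))"
          by (rule sum.over_tagged_division_lemma[OF tp']) (auto simp: that antisym)
        have **: "k \<noteq> {}" if "(x, k) \<in> p1" for x k
          using iv[of x k] that by (auto simp: p1_def)
        have "(\<Sum>(x,k)\<in>p1. h (Inf k) (Sup k)) = (\<Sum>(x,k)\<in>p1. (if k = {} then 0 else h (Inf k) (Sup k)))"
          using ** by (intro sum.cong) auto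
        also note *
        also have "(\<Sum>k\<in>snd ` p1. (if k = {} then 0 else h (Inf k) (Sup k))) = (\<Sum>k\<in>snd ` p1. h (Inf k) (Sup k))"
          using ** by (intro sum.cong) auto
        finally show ?thesis .
      qed
      have dv: "(snd ` p1) division_of (\<Union>(snd ` p1))"
        using partial_division_of_tagged_division[OF tp] .
      have sub: "\<Union>(snd ` p1) \<subseteq> {a..b}" "\<Union>(snd ` p1) \<subseteq> U"
        using iv rN by (fastforce simp: p1_def)+
      have "(\<Sum>k\<in>snd ` p1. Sup k - Inf k) = (\<Sum>k\<in>snd ` p1. measure lebesgue k)"
        using iv by (intro sum.cong) (fastforce simp: p1_def measure_completion)+
      also have "\<dots> = measure lebesgue (\<Union>(snd ` p1))" using content_division[OF dv] by simp
      also have "\<dots> \<le> measure lebesgue U"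
        using sub Um dv by (intro measure_mono_fmeasurable) (auto simp: lmeasurable_division fmeasurableD)
      finally have len: "(\<Sum>k\<in>snd ` p1. Sup k - Inf k) < \<eta>" using mU by simp
      then have "(\<Sum>k\<in>snd ` p1. norm (g (Sup k) - g (Inf k))) < e" using ac\<delta>[OF dv sub(1)] \<eta>(2) by simp
      moreover have "(\<Sum>(x,k)\<in>p1. norm (g (Sup k) - g (Inf k))) = (\<Sum>k\<in>snd ` p1. norm (g (Sup k) - g (Inf k)))"
        using sum_snd[of "\<lambda>u v. norm (g v - g u)"] by simp
      moreover have "(\<Sum>(x,k)\<in>p1. g (Sup k) - g (Inf k)) \<le> (\<Sum>(x,k)\<in>p1. norm (g (Sup k) - g (Inf k)))"
        by (intro sum_mono) auto
      ultimately show "(\<Sum>(x,k)\<in>p1. g (Sup k) - g (Inf k)) \<le> e" by linarith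
      have "0 \<le> (\<Sum>(x,k)\<in>p1. Sup k - Inf k)"
        using iv by (intro sum_nonneg) (fastforce simp: p1_def)
      then show "\<bar>\<Sum>(x,k)\<in>p1. Sup k - Inf k\<bar> < \<eta>"
        using len sum_snd[of "\<lambda>u v. v - u"] by simp
    qed
    have "g b - g a = (\<Sum>(x,k)\<in>p. g (Sup k) - g (Inf k))"
      using additive_tagged_division_1[OF ab p(1), of g] by simp
    also have "\<dots> = (\<Sum>(x,k)\<in>p1. g (Sup k) - g (Inf k)) + (\<Sum>(x,k)\<in>p2. g (Sup k) - g (Inf k))"
      using pp by (metis (no_types, lifting) sum.union_disjoint)
    also note p1(1)
    also have "(\<Sum>(x,k)\<in>p2. g (Sup k) - g (Inf k)) \<le> (\<Sum>(x,k)\<in>p2. (m + e) * (Sup k - Inf k))"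
    proof (intro sum_mono, clarify)
      fix x k assume xk: "(x,k) \<in> p2"
      then obtain u v where "k = {u..v}" "u \<le> v" "x \<in> {u..v}" "{u..v} \<subseteq> {a..b}" "{u..v} \<subseteq> ball x (r x)"
        using iv[of x k] by (auto simp: p2_def)
      then show "g (Sup k) - g (Inf k) \<le> (m + e) * (Sup k - Inf k)"
        using rD[of x u v] xk by (auto simp: p2_def subset_iff)
    qed
    \<comment> \<open>As \<open>m + e\<close> may be negative, the total length over
      \<open>p2\<close> cannot just be bounded by \<open>b - a\<close>; the length over
      \<open>p1\<close> is subtracted exactly and estimated by \<open>\<eta>\<close>.\<close>
    also have "\<dots> = (\<Sum>(x,k)\<in>p. (m + e) * (Sup k - Inf k)) - (\<Sum>(x,k)\<in>p1. (m + e) * (Sup k - Inf k))"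
      unfolding pp(1) using pp by (subst sum.union_disjoint) auto
    also have "(\<Sum>(x,k)\<in>p. (m + e) * (Sup k - Inf k)) = (m + e) * (b - a)"
      using additive_tagged_division_1[OF ab p(1), of "\<lambda>x. (m + e) * x"] by (simp add: right_diff_distrib)
    finally have "g b - g a \<le> e + ((m + e) * (b - a) - (m + e) * (\<Sum>(x,k)\<in>p1. Sup k - Inf k))"
      by (simp add: sum_distrib_left case_prod_beta')
    moreover have "\<bar>(m + e) * (\<Sum>(x,k)\<in>p1. Sup k - Inf k)\<bar> \<le> \<bar>m + e\<bar> * \<eta>"
      using p1(2) by (simp add: abs_mult mult_left_mono)
    ultimately show ?thesis using \<eta>(3) by linarith
  qed
  have "((\<lambda>e. (m + e) * (b - a) + 2 * e) \<longlongrightarrow> (m + 0) * (b - a) + 2 * 0) (at_right 0)"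
    by (intro tendsto_intros)
  moreover have "eventually (\<lambda>e. g b - g a \<le> (m + e) * (b - a) + 2 * e) (at_right 0)"
    by (rule eventually_mono[OF eventually_at_right_less main])
  ultimately show ?thesis using tendsto_lowerbound[OF _ _ trivial_limit_at_right_real] by fastforce
qed

section \<open>Absolutely continuous curves, compact graphs and difference quotients\<close>

lemma absolutely_continuous_curve_continuous:
  assumes "absolutely_continuous_curve {a..b} c"
  shows "continuous_on {a..b} c"
  unfolding continuous_on_iff
proof (intro ballI allI impI)
  fix t e :: real assume t: "t \<in> {a..b}" "0 < e"
  obtain \<delta> where \<delta>: "\<delta> > 0"
    and ac: "\<And>d T. d division_of T \<Longrightarrow> T \<subseteq> {a..b} \<Longrightarrow> (\<Sum>k\<in>d. Sup k - Inf k) < \<delta>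
        \<Longrightarrow> (\<Sum>k\<in>d. norm (c (Sup k) - c (Inf k))) < e"
    using assms t(2) unfolding absolutely_continuous_curve_def by metis
  have *: "norm (c v - c u) < e" if "u \<le> v" "u \<in> {a..b}" "v \<in> {a..b}" "v - u < \<delta>" for u v
    using ac[OF division_of_self[of u v, unfolded cbox_interval]] that by simp
  show "\<exists>d>0. \<forall>s\<in>{a..b}. dist s t < d \<longrightarrow> dist (c s) (c t) < e"
  proof (intro exI[of _ \<delta>] conjI ballI impI \<delta>)
    fix s assume "s \<in> {a..b}" "dist s t < \<delta>"
    then show "dist (c s) (c t) < e"
      using *[of s t] *[of t s] t(1) by (cases "s \<le> t") (auto simp: dist_norm norm_minus_commute)
  qed
qed

lemma absolutely_continuous_curve_subset:
  assumes "absolutely_continuous_curve I c" "J \<subseteq> I"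
  shows "absolutely_continuous_curve J c"
  using assms unfolding absolutely_continuous_curve_def by (meson order_trans)

lemma absolutely_continuous_curve_lipschitz:
  assumes ac: "absolutely_continuous_curve I c"
    and lip: "\<And>s t. s \<in> I \<Longrightarrow> t \<in> I \<Longrightarrow> norm (g s - g t) \<le> L * norm (c s - c t)"
  shows "absolutely_continuous_curve I g"
  unfolding absolutely_continuous_curve_def
proof (intro allI impI)
  fix e :: real assume "e > 0"
  then have "e / (\<bar>L\<bar> + 1) > 0" by simp
  then obtain \<delta> where \<delta>: "\<delta> > 0" and a: "\<And>d T. d division_of T \<Longrightarrow> T \<subseteq> I \<Longrightarrow> (\<Sum>k\<in>d. Sup k - Inf k) < \<delta>
        \<Longrightarrow> (\<Sum>k\<in>d. norm (c (Sup k) - c (Inf k))) < e / (\<bar>L\<bar> + 1)"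
    using ac unfolding absolutely_continuous_curve_def by metis
  have "(\<Sum>k\<in>d. norm (g (Sup k) - g (Inf k))) < e"
    if d: "d division_of T" "T \<subseteq> I" "(\<Sum>k\<in>d. Sup k - Inf k) < \<delta>" for d T
  proof -
    have "norm (g (Sup k) - g (Inf k)) \<le> (\<bar>L\<bar> + 1) * norm (c (Sup k) - c (Inf k))" if kd: "k \<in> d" for k
    proof -
      obtain u v where k: "k = {u..v}" "k \<noteq> {}" "k \<subseteq> I"
        using division_ofD(2-4)[OF d(1) kd] d(2) unfolding cbox_interval by (metis order_trans)
      then have "Sup k \<in> I" "Inf k \<in> I" by (auto simp: subset_iff)
      then have "norm (g (Sup k) - g (Inf k)) \<le> L * norm (c (Sup k) - c (Inf k))" by (rule lip)
      also have "\<dots> \<le> (\<bar>L\<bar> + 1) * norm (c (Sup k) - c (Inf k))" by (intro mult_right_mono) auto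
      finally show ?thesis .
    qed
    then have "(\<Sum>k\<in>d. norm (g (Sup k) - g (Inf k))) \<le> (\<Sum>k\<in>d. (\<bar>L\<bar> + 1) * norm (c (Sup k) - c (Inf k)))"
      by (rule sum_mono)
    also have "\<dots> = (\<bar>L\<bar> + 1) * (\<Sum>k\<in>d. norm (c (Sup k) - c (Inf k)))"
      by (simp add: sum_distrib_left)
    also have "\<dots> < e" using a[OF d] by (simp add: field_simps)
    finally show ?thesis .
  qed
  then show "\<exists>\<delta>>0. \<forall>d T. d division_of T \<and> T \<subseteq> I \<and> (\<Sum>k\<in>d. Sup k - Inf k) < \<delta> \<longrightarrow>
        (\<Sum>k\<in>d. norm (g (Sup k) - g (Inf k))) < e"
    using \<delta> by blast
qed

text \<open>The points of \<open>K\<close> whose second component is at distance at least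
  \<open>e\<close> from the fibre over \<open>x\<close> form a compact set; its projection is closed
  and misses \<open>x\<close>. If the fibre over \<open>x\<close> is empty, this says that the
  nearby fibres are empty as well.\<close>

lemma compact_graph_upper_semicontinuous:
  fixes K :: "('a::metric_space \<times> 'b::metric_space) set"
  assumes K: "compact K" and e: "e > 0"
  shows "\<exists>d>0. \<forall>y z. (y, z) \<in> K \<longrightarrow> dist y x < d \<longrightarrow> (\<exists>z'. (x, z') \<in> K \<and> dist z z' < e)"
proof -
  define C where "C = K \<inter> (\<Inter>z'\<in>{z'. (x, z') \<in> K}. {p. e \<le> dist (snd p) z'})"
  have "closed {p :: 'a \<times> 'b. e \<le> dist (snd p) z'}" for z'
    by (intro closed_Collect_le continuous_intros)
  then have "compact C" unfolding C_def by (intro compact_Int_closed K closed_INT) auto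
  then have "compact (fst ` C)" by (intro compact_continuous_image continuous_intros)
  then have "open (- (fst ` C))" by (simp add: compact_imp_closed open_Compl)
  moreover have "x \<in> - (fst ` C)" using e by (auto simp: C_def) (metis dist_self not_le)
  ultimately obtain d where "d > 0" "ball x d \<subseteq> - (fst ` C)" by (meson open_contains_ball)
  then have "\<exists>z'. (x, z') \<in> K \<and> dist z z' < e" if "(y, z) \<in> K" "dist y x < d" for y z
    using that by (force simp: C_def subset_iff dist_commute not_le)
  then show ?thesis using \<open>d > 0\<close> by blast
qed

text \<open>The limit is taken along an arbitrary \<open>T\<close> because the quotient will be
  followed only along the times at which the curve lies in a fixed set
  \<open>near_pair\<close>.\<close>

lemma has_vector_derivative_difference_quotient:
  assumes "(c has_vector_derivative v) (at t)"
  shows "((\<lambda>s. (1 / (s - t)) *\<^sub>R (c s - c t)) \<longlongrightarrow> v) (at t within T)"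
proof -
  have "((\<lambda>s. (1 / norm (s - t)) *\<^sub>R (c s - (c t + (s - t) *\<^sub>R v))) \<longlongrightarrow> 0) (at t within T)"
    using has_vector_derivative_at_within[OF assms, of T]
    unfolding has_vector_derivative_def has_derivative_within by blast
  moreover have "eventually (\<lambda>s. norm ((1 / norm (s - t)) *\<^sub>R (c s - (c t + (s - t) *\<^sub>R v)))
      = norm ((1 / (s - t)) *\<^sub>R (c s - c t) - v)) (at t within T)"
    unfolding eventually_at_filter
  proof (intro always_eventually allI impI)
    fix s :: real assume "s \<noteq> t"
    then have "(1 / (s - t)) *\<^sub>R (c s - c t) - v = (1 / (s - t)) *\<^sub>R (c s - (c t + (s - t) *\<^sub>R v))"
      by (simp add: scaleR_diff_right scaleR_add_right)
    then show "norm ((1 / norm (s - t)) *\<^sub>R (c s - (c t + (s - t) *\<^sub>R v)))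
      = norm ((1 / (s - t)) *\<^sub>R (c s - c t) - v)" by simp
  qed
  ultimately have "((\<lambda>s. norm ((1 / (s - t)) *\<^sub>R (c s - c t) - v)) \<longlongrightarrow> 0) (at t within T)"
    using tendsto_norm_zero tendsto_cong by fastforce
  then show ?thesis by (simp add: LIM_zero_cancel tendsto_norm_zero_iff)
qed

lemma least_norm_in:
  assumes "compact C" "C \<noteq> {}"
  shows "least_norm C \<in> C"
proof -
  obtain x where "x \<in> C" "\<forall>y\<in>C. norm x \<le> norm y"
    using continuous_attains_inf[OF assms, of norm] by (auto intro: continuous_intros)
  then have "is_arg_min norm (\<lambda>x. x \<in> C) x" by (auto simp: is_arg_min_def not_less)
  then have "is_arg_min norm (\<lambda>x. x \<in> C) (least_norm C)"
    unfolding least_norm_def arg_min_on_def arg_min_def by (rule someI)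
  then show ?thesis by (simp add: is_arg_min_def)
qed

section \<open>Functions with piecewise subgradients\<close>

text \<open>Each \<open>G \<in> \<G>\<close> is the graph of a set-valued map that assigns to the points of a piece of the
  domain subgradients of the restriction of \<open>f\<close> to this piece; the pieces cover \<open>D\<close>. There is no
  convexity of \<open>f\<close> across different pieces.\<close>

locale subgradient_cover =
  fixes D :: "'a::euclidean_space set" and f :: "'a \<Rightarrow> real" and L :: real
    and \<G> :: "('a \<times> 'a) set set"
  assumes compact_D: "compact D" and convex_D: "convex D"
    and lipschitz: "L-lipschitz_on UNIV f"
    and finite_cover: "finite \<G>"
    and compact_graph: "G \<in> \<G> \<Longrightarrow> compact G"
    and subgradient: "G \<in> \<G> \<Longrightarrow> (x, z) \<in> G \<Longrightarrow> (y, w) \<in> G \<Longrightarrow> f x + z \<bullet> (y - x) \<le> f y"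
    and cover: "x \<in> D \<Longrightarrow> \<exists>z. (x, z) \<in> \<Union>\<G>"
    and gradient: "x \<in> interior D \<Longrightarrow> GDERIV f x :> g \<Longrightarrow> (x, g) \<in> \<Union>\<G>"
begin

text \<open>The subgradients need only be close to fixed centres \<open>a\<close> and
  \<open>b\<close>. With centres from a countable dense set and radii \<open>1 / Suc n\<close>,
  countably many such sets account for all pairs of subgradients.\<close>

definition near_pair :: "('a \<times> 'a) set \<Rightarrow> ('a \<times> 'a) set \<Rightarrow> 'a \<Rightarrow> 'a \<Rightarrow> real \<Rightarrow> 'a set" where
  "near_pair G H a b e = {x. (\<exists>z. (x, z) \<in> G \<and> dist a z < e) \<and> (\<exists>w. (x, w) \<in> H \<and> dist b w < e)}"

lemma compact_Union: "compact (\<Union>\<G>)"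
  using finite_cover compact_graph by (intro compact_Union) auto

text \<open>Adding the subgradient inequalities for \<open>z\<close> at \<open>x\<close> and for
  \<open>w\<close> at \<open>y\<close> cancels the values of \<open>f\<close> and leaves
  \<open>(z - w) \<bullet> (y - x) \<le> 0\<close>. Passing to the centres costs \<open>e\<close>
  for each vector, and exchanging \<open>x\<close> and \<open>y\<close> gives the other
  sign.\<close>

lemma near_pair_thin:
  assumes "G \<in> \<G>" "H \<in> \<G>" "x \<in> near_pair G H a b e" "y \<in> near_pair G H a b e"
  shows "\<bar>(a - b) \<bullet> (y - x)\<bar> \<le> 2 * e * norm (y - x)"
proof -
  have *: "(a - b) \<bullet> (y - x) \<le> 2 * e * norm (y - x)"
    if xy: "x \<in> near_pair G H a b e" "y \<in> near_pair G H a b e" for x y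
  proof -
    obtain z where z: "(x, z) \<in> G" "dist a z < e" using xy(1) by (auto simp: near_pair_def)
    obtain w where w: "(y, w) \<in> H" "dist b w < e" using xy(2) by (auto simp: near_pair_def)
    \<comment> \<open>\<open>z'\<close> and \<open>w'\<close> only certify that \<open>y\<close>
      belongs to the piece of \<open>G\<close> and \<open>x\<close> to the piece of
      \<open>H\<close>.\<close>
    obtain z' where z': "(y, z') \<in> G" using xy(2) by (auto simp: near_pair_def)
    obtain w' where w': "(x, w') \<in> H" using xy(1) by (auto simp: near_pair_def)
    have "f x + z \<bullet> (y - x) \<le> f y" using subgradient[OF assms(1) z(1) z'] .
    moreover have "f y + w \<bullet> (x - y) \<le> f x" using subgradient[OF assms(2) w(1) w'] .
    ultimately have 1: "z \<bullet> (y - x) - w \<bullet> (y - x) \<le> 0" by (simp add: inner_diff_right)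
    have "(a - z) \<bullet> (y - x) \<le> norm (a - z) * norm (y - x)" by (rule norm_cauchy_schwarz)
    also have "\<dots> \<le> e * norm (y - x)" using z(2) by (intro mult_right_mono) (auto simp: dist_norm)
    finally have 2: "(a - z) \<bullet> (y - x) \<le> e * norm (y - x)" .
    have "(w - b) \<bullet> (y - x) \<le> norm (w - b) * norm (y - x)" by (rule norm_cauchy_schwarz)
    also have "\<dots> \<le> e * norm (y - x)"
      using w(2) by (intro mult_right_mono) (auto simp: dist_norm norm_minus_commute)
    finally have "(w - b) \<bullet> (y - x) \<le> e * norm (y - x)" .
    with 1 2 show ?thesis by (simp add: inner_diff_left)
  qed
  show ?thesis
    using *[OF assms(3,4)] *[OF assms(4,3)] by (simp add: abs_le_iff inner_diff_right norm_minus_commute)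
qed

definition dense_points :: "'a set" where
  "dense_points = (SOME Q. countable Q \<and> (\<forall>U. open U \<longrightarrow> U \<noteq> {} \<longrightarrow> (\<exists>y\<in>Q. y \<in> U)))"

lemma dense_points: "countable dense_points" "open U \<Longrightarrow> U \<noteq> {} \<Longrightarrow> \<exists>y\<in>dense_points. y \<in> U"
proof -
  obtain Q :: "'a set" where "countable Q" "\<And>U. open U \<Longrightarrow> U \<noteq> {} \<Longrightarrow> \<exists>y\<in>Q. y \<in> U"
    using countable_dense_exists by blast
  then have "\<exists>Q :: 'a set. countable Q \<and> (\<forall>U. open U \<longrightarrow> U \<noteq> {} \<longrightarrow> (\<exists>y\<in>Q. y \<in> U))"
    by auto
  from someI_ex[OF this] show "countable dense_points"
    "open U \<Longrightarrow> U \<noteq> {} \<Longrightarrow> \<exists>y\<in>dense_points. y \<in> U"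
    unfolding dense_points_def by auto
qed

definition pair_indices :: "(('a \<times> 'a) set \<times> ('a \<times> 'a) set \<times> 'a \<times> 'a \<times> nat) set" where
  "pair_indices = \<G> \<times> \<G> \<times> dense_points \<times> dense_points \<times> UNIV"

lemma countable_pair_indices: "countable pair_indices"
  unfolding pair_indices_def using dense_points(1) finite_cover by (simp add: countable_finite)

lemma near_pair_cover:
  assumes zw: "(x, z) \<in> \<Union>\<G>" "(x, w) \<in> \<Union>\<G>"
  shows "\<exists>G H a b. (G, H, a, b, n) \<in> pair_indices \<and> x \<in> near_pair G H a b (1 / Suc n) \<and>
         dist a z < 1 / Suc n \<and> dist b w < 1 / Suc n"
proof -
  obtain G H where GH: "G \<in> \<G>" "(x, z) \<in> G" "H \<in> \<G>" "(x, w) \<in> H" using zw by blast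
  obtain a where a: "a \<in> dense_points" "dist a z < 1 / Suc n"
    using dense_points(2)[of "ball z (1 / Suc n)"] by (auto simp: dist_commute)
  obtain b where b: "b \<in> dense_points" "dist b w < 1 / Suc n"
    using dense_points(2)[of "ball w (1 / Suc n)"] by (auto simp: dist_commute)
  have "x \<in> near_pair G H a b (1 / Suc n)" using GH a b unfolding near_pair_def by blast
  then show ?thesis using GH a b unfolding pair_indices_def by blast
qed

lemma negligible_multiple_subgradients:
  "negligible {x. \<exists>z w. (x, z) \<in> \<Union>\<G> \<and> (x, w) \<in> \<Union>\<G> \<and> z \<noteq> w}" (is "negligible ?N")
proof -
  define F where "F = (\<lambda>(G, H, a, b, n::nat). if 2 * (1 / Suc n) < norm (a - b)
     then near_pair G H a b (1 / Suc n) else {})"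
  have "negligible (F i)" if "i \<in> pair_indices" for i
  proof -
    obtain G H a b n where i: "i = (G, H, a, b, n)" by (cases i) auto
    show ?thesis
    proof (cases "2 * (1 / Suc n) < norm (a - b)")
      case True
      then show ?thesis
        using that unfolding F_def i pair_indices_def
        by (auto intro!: negligible_thin_cone[of "2 * (1 / Suc n)" "a - b"] near_pair_thin[of G H] simp del: of_nat_Suc)
    qed (auto simp: F_def i)
  qed
  then have "negligible (\<Union>i\<in>pair_indices. F i)" using countable_pair_indices by (intro negligible_countable_Union) auto
  moreover have "?N \<subseteq> (\<Union>i\<in>pair_indices. F i)"
  proof
    fix x assume "x \<in> ?N"
    then obtain z w where zw: "(x, z) \<in> \<Union>\<G>" "(x, w) \<in> \<Union>\<G>" "z \<noteq> w" by blast
    \<comment> \<open>A quarter, because each centre is off by less than \<open>1 / Suc n\<close>: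
      of the distance \<open>4 / Suc n\<close> more than \<open>2 / Suc n\<close> remains between
      \<open>a\<close> and \<open>b\<close>, which is the cone constant in
      \<open>near_pair_thin\<close>.\<close>
    then obtain n where n: "inverse (real (Suc n)) < dist z w / 4"
      using reals_Archimedean[of "dist z w / 4"] by auto
    obtain G H a b where *: "(G, H, a, b, n) \<in> pair_indices" "x \<in> near_pair G H a b (1 / Suc n)"
        "dist a z < 1 / Suc n" "dist b w < 1 / Suc n"
      using near_pair_cover[OF zw(1,2)] by blast
    have "dist z w \<le> dist a z + norm (a - b) + dist b w"
      unfolding dist_norm[symmetric] by metric
    then have "2 * (1 / Suc n) < norm (a - b)" using * n by (simp add: inverse_eq_divide)
    then show "x \<in> (\<Union>i\<in>pair_indices. F i)" using * by (intro UN_I[OF *(1)]) (simp add: F_def)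
  qed
  ultimately show ?thesis by (rule negligible_subset)
qed

text \<open>The subgradient \<open>z\<close> at \<open>x\<close> may depend on \<open>y\<close>. It
  is chosen in the same piece as a subgradient \<open>w\<close> at \<open>y\<close> and close to
  \<open>w\<close>, by upper semicontinuity; \<open>z\<close> bounds the increment from below and
  \<open>w\<close> bounds it from above.\<close>

lemma local_expansion:
  assumes "e > 0"
  shows "\<exists>d>0. \<forall>y\<in>D. dist y x < d \<longrightarrow>
    (\<exists>z. (x, z) \<in> \<Union>\<G> \<and> \<bar>f y - f x - z \<bullet> (y - x)\<bar> \<le> e * norm (y - x))"
proof -
  have "\<forall>G\<in>\<G>. \<exists>d>0. \<forall>y z. (y, z) \<in> G \<longrightarrow> dist y x < d \<longrightarrow> (\<exists>z'. (x, z') \<in> G \<and> dist z z' < e)"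
    using compact_graph_upper_semicontinuous[OF compact_graph assms] by blast
  then obtain d where d: "\<And>G. G \<in> \<G> \<Longrightarrow> d G > 0"
    "\<And>G y z. G \<in> \<G> \<Longrightarrow> (y, z) \<in> G \<Longrightarrow> dist y x < d G \<Longrightarrow> \<exists>z'. (x, z') \<in> G \<and> dist z z' < e"
    by metis
  define r where "r = Min (insert 1 (d ` \<G>))"
  have r: "r > 0" "\<And>G. G \<in> \<G> \<Longrightarrow> r \<le> d G"
    using d(1) finite_cover by (auto simp: r_def)
  have "\<exists>z. (x, z) \<in> \<Union>\<G> \<and> \<bar>f y - f x - z \<bullet> (y - x)\<bar> \<le> e * norm (y - x)"
    if y: "y \<in> D" "dist y x < r" for y
  proof -
    obtain w G where w: "G \<in> \<G>" "(y, w) \<in> G" using cover[OF y(1)] by blast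
    then obtain z where z: "(x, z) \<in> G" "dist w z < e" using d(2)[OF w] y(2) r(2)[OF w(1)] by auto
    have "f x + z \<bullet> (y - x) \<le> f y" using subgradient[OF w(1) z(1) w(2)] .
    moreover have "f y + w \<bullet> (x - y) \<le> f x" using subgradient[OF w(1) w(2) z(1)] .
    moreover have "(w - z) \<bullet> (y - x) \<le> e * norm (y - x)"
      using norm_cauchy_schwarz[of "w - z" "y - x"] z(2)
        mult_right_mono[of "norm (w - z)" e "norm (y - x)"] by (simp add: dist_norm)
    ultimately have "\<bar>f y - f x - z \<bullet> (y - x)\<bar> \<le> e * norm (y - x)"
      by (simp add: abs_le_iff inner_diff_left inner_diff_right)
    then show ?thesis using w z by blast
  qed
  then show ?thesis using r(1) by blast
qed

text \<open>In \<open>local_expansion\<close> the subgradient varies with the nearby point; the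
  hypothesis \<open>single\<close> makes all choices agree on the tangent of the curve. The identity
  as \<open>\<gamma>\<close> yields differentiability in the interior, a solution as
  \<open>\<gamma>\<close> its rate.\<close>

lemma chain_rule:
  assumes \<gamma>: "(\<gamma> has_derivative \<gamma>') (at t within T)" and t: "t \<in> T"
    and D: "\<And>s. s \<in> T \<Longrightarrow> \<gamma> s \<in> D"
    and single: "\<And>z h. (\<gamma> t, z) \<in> \<Union>\<G> \<Longrightarrow> z \<bullet> \<gamma>' h = \<phi> h"
  shows "((\<lambda>s. f (\<gamma> s)) has_derivative \<phi>) (at t within T)"
  unfolding has_derivative_within_alt
proof (intro conjI allI impI)
  have bl: "bounded_linear \<gamma>'" using \<gamma> by (rule has_derivative_bounded_linear)
  obtain z0 where z0: "(\<gamma> t, z0) \<in> \<Union>\<G>" using cover[OF D[OF t]] by blast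
  have "\<phi> = (\<lambda>h. z0 \<bullet> \<gamma>' h)" using single[OF z0] by auto
  then show "bounded_linear \<phi>"
    using bounded_linear_compose[OF bounded_linear_inner_right bl] by simp
  obtain B where B: "B > 0" "\<And>p. p \<in> \<Union>\<G> \<Longrightarrow> norm p \<le> B"
    using compact_imp_bounded[OF compact_Union] by (meson bounded_pos)
  obtain k where k: "k > 0" "\<And>h. norm (\<gamma>' h) \<le> norm h * k"
    using bounded_linear.pos_bounded[OF bl] by blast
  fix e :: real assume e: "e > 0"
  \<comment> \<open>\<open>e1\<close> pays with \<open>B * e1 \<le> e / 2\<close> for the deviation
    of the curve from its tangent, \<open>e2\<close> with \<open>e2 * (k + 1) = e / 2\<close> for
    the error of the expansion; the cap 1 turns \<open>k + 1\<close> into a local Lipschitz bound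
    for \<open>\<gamma>\<close> at \<open>t\<close>.\<close>
  define e1 where "e1 = min 1 (e / (2 * B))"
  define e2 where "e2 = e / (2 * (k + 1))"
  have pos: "e1 > 0" "e2 > 0" using e B k by (auto simp: e1_def e2_def)
  obtain d1 where d1: "d1 > 0" "\<And>s. s \<in> T \<Longrightarrow> norm (s - t) < d1 \<Longrightarrow>
      norm (\<gamma> s - \<gamma> t - \<gamma>' (s - t)) \<le> e1 * norm (s - t)"
    using \<gamma> pos(1) unfolding has_derivative_within_alt by metis
  obtain d2 where d2: "d2 > 0" "\<And>y. y \<in> D \<Longrightarrow> dist y (\<gamma> t) < d2 \<Longrightarrow>
    \<exists>z. (\<gamma> t, z) \<in> \<Union>\<G> \<and> \<bar>f y - f (\<gamma> t) - z \<bullet> (y - \<gamma> t)\<bar> \<le> e2 * norm (y - \<gamma> t)"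
    using local_expansion[OF pos(2)] by metis
  define d where "d = min d1 (d2 / (k + 1))"
  have "d > 0" using d1(1) d2(1) k(1) by (simp add: d_def)
  moreover have "norm (f (\<gamma> s) - f (\<gamma> t) - \<phi> (s - t)) \<le> e * norm (s - t)"
    if s: "s \<in> T" "norm (s - t) < d" for s
  proof -
    have 1: "norm (\<gamma> s - \<gamma> t - \<gamma>' (s - t)) \<le> e1 * norm (s - t)" using d1(2) s by (simp add: d_def)
    have "norm (\<gamma> s - \<gamma> t) \<le> norm (\<gamma> s - \<gamma> t - \<gamma>' (s - t)) + norm (\<gamma>' (s - t))" by norm
    also have "\<dots> \<le> e1 * norm (s - t) + norm (s - t) * k" using 1 k(2) by (intro add_mono) auto
    also have "\<dots> \<le> 1 * norm (s - t) + norm (s - t) * k"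
      by (intro add_mono mult_right_mono) (use k(1) in \<open>auto simp: e1_def\<close>)
    finally have 2: "norm (\<gamma> s - \<gamma> t) \<le> (k + 1) * norm (s - t)" by (simp add: algebra_simps)
    also have "\<dots> < d2" using s(2) k(1) by (simp add: d_def field_simps)
    finally obtain z where z: "(\<gamma> t, z) \<in> \<Union>\<G>"
      "\<bar>f (\<gamma> s) - f (\<gamma> t) - z \<bullet> (\<gamma> s - \<gamma> t)\<bar> \<le> e2 * norm (\<gamma> s - \<gamma> t)"
      using d2(2)[OF D[OF s(1)]] by (auto simp: dist_norm)
    have "norm z \<le> B" using B(2)[OF z(1)] norm_snd_le[of z "\<gamma> t"] by simp
    have "\<bar>z \<bullet> (\<gamma> s - \<gamma> t) - \<phi> (s - t)\<bar> = \<bar>z \<bullet> (\<gamma> s - \<gamma> t - \<gamma>' (s - t))\<bar>"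
      using single[OF z(1), of "s - t"] by (simp add: inner_diff_right)
    also have "\<dots> \<le> norm z * norm (\<gamma> s - \<gamma> t - \<gamma>' (s - t))" by (rule Cauchy_Schwarz_ineq2)
    also have "\<dots> \<le> B * (e1 * norm (s - t))" using \<open>norm z \<le> B\<close> 1 B(1) by (intro mult_mono) auto
    also have "\<dots> \<le> B * (e / (2 * B) * norm (s - t))"
      using B(1) by (intro mult_left_mono mult_right_mono) (auto simp: e1_def)
    also have "\<dots> = e / 2 * norm (s - t)" using B(1) by simp
    finally have 3: "\<bar>z \<bullet> (\<gamma> s - \<gamma> t) - \<phi> (s - t)\<bar> \<le> e / 2 * norm (s - t)" .
    have "e2 * norm (\<gamma> s - \<gamma> t) \<le> e2 * ((k + 1) * norm (s - t))"
      using 2 pos(2) by (intro mult_left_mono) auto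
    also have "\<dots> = e / 2 * norm (s - t)" using k(1) by (simp add: e2_def field_simps)
    finally have 4: "e2 * norm (\<gamma> s - \<gamma> t) \<le> e / 2 * norm (s - t)" .
    have "\<bar>f (\<gamma> s) - f (\<gamma> t) - \<phi> (s - t)\<bar>
        \<le> \<bar>f (\<gamma> s) - f (\<gamma> t) - z \<bullet> (\<gamma> s - \<gamma> t)\<bar> + \<bar>z \<bullet> (\<gamma> s - \<gamma> t) - \<phi> (s - t)\<bar>"
      by linarith
    also have "\<dots> \<le> e / 2 * norm (s - t) + e / 2 * norm (s - t)"
      using z(2) 3 4 by (intro add_mono) linarith+
    finally show ?thesis by simp
  qed
  ultimately show "\<exists>d>0. \<forall>s\<in>T. norm (s - t) < d \<longrightarrow> norm (f (\<gamma> s) - f (\<gamma> t) - \<phi> (s - t)) \<le> e * norm (s - t)"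
    by blast
qed

lemma differentiable_at_single_subgradient:
  assumes x: "x \<in> interior D" and z: "\<And>w. (x, w) \<in> \<Union>\<G> \<Longrightarrow> w = z"
  shows "GDERIV f x :> z"
proof -
  have "((\<lambda>s. f (id s)) has_derivative (\<lambda>h. h \<bullet> z)) (at x within interior D)"
    using z interior_subset[of D] x
    by (intro chain_rule[where \<gamma>' = id]) (auto simp: inner_commute id_def)
  then show ?thesis using x by (simp add: gderiv_def at_within_open[OF x open_interior])
qed

text \<open>If \<open>t\<close> is an accumulation point of the times spent in a set
  \<open>near_pair\<close>, the difference quotients along these times obey its cone inequality, and
  so does their limit \<open>v\<close>. Only isolated times escape, countably many for each
  index.\<close>

lemma countable_ambiguous_times:
  "countable {t. \<exists>v z w. (P has_vector_derivative v) (at t) \<and> (P t, z) \<in> \<Union>\<G> \<and> (P t, w) \<in> \<Union>\<G> \<and> z \<bullet> v \<noteq> w \<bullet> v}"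
    (is "countable ?N")
proof -
  define T where "T = (\<lambda>(G, H, a, b, n::nat). {t :: real. P t \<in> near_pair G H a b (1 / Suc n)})"
  have "countable (\<Union>i\<in>pair_indices. {t \<in> T i. \<not> t islimpt T i})"
    using countable_pair_indices countable_isolated_points by blast
  moreover have "?N \<subseteq> (\<Union>i\<in>pair_indices. {t \<in> T i. \<not> t islimpt T i})"
  proof (rule ccontr)
    assume "\<not> ?thesis"
    then obtain t v z w where v: "(P has_vector_derivative v) (at t)"
      and zw: "(P t, z) \<in> \<Union>\<G>" "(P t, w) \<in> \<Union>\<G>" "z \<bullet> v \<noteq> w \<bullet> v"
      and lim: "\<And>i. i \<in> pair_indices \<Longrightarrow> t \<in> T i \<Longrightarrow> t islimpt T i" by blast
    \<comment> \<open>The factor 4 is 2 from the cone plus 1 for each of the replacements of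
      \<open>z\<close> by \<open>a\<close> and of \<open>w\<close> by \<open>b\<close>.\<close>
    have est: "\<bar>(z - w) \<bullet> v\<bar> \<le> 4 * (1 / Suc n) * norm v" for n
    proof -
      let ?e = "1 / real (Suc n)"
      obtain G H a b where i: "(G, H, a, b, n) \<in> pair_indices" "P t \<in> near_pair G H a b ?e"
          "dist a z < ?e" "dist b w < ?e"
        using near_pair_cover[OF zw(1,2)] by blast
      let ?T = "T (G, H, a, b, n)"
      have T: "P s \<in> near_pair G H a b ?e" if "s \<in> ?T" for s using that by (simp add: T_def)
      have tr: "at t within ?T \<noteq> bot"
        using lim[OF i(1)] i(2) by (simp add: T_def trivial_limit_within)
      have q: "((\<lambda>s. (1 / (s - t)) *\<^sub>R (P s - P t)) \<longlongrightarrow> v) (at t within ?T)"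
        by (rule has_vector_derivative_difference_quotient[OF v])
      have ev: "eventually (\<lambda>s. \<bar>(a - b) \<bullet> ((1 / (s - t)) *\<^sub>R (P s - P t))\<bar>
           \<le> 2 * ?e * norm ((1 / (s - t)) *\<^sub>R (P s - P t))) (at t within ?T)"
        unfolding eventually_at_filter
      proof (intro always_eventually allI impI)
        fix s assume "s \<in> ?T"
        then have "\<bar>(a - b) \<bullet> (P s - P t)\<bar> \<le> 2 * ?e * norm (P s - P t)"
          using i(1,2) T unfolding pair_indices_def by (intro near_pair_thin[of G H]) auto
        then have "\<bar>1 / (s - t)\<bar> * \<bar>(a - b) \<bullet> (P s - P t)\<bar> \<le> \<bar>1 / (s - t)\<bar> * (2 * ?e * norm (P s - P t))"
          by (rule mult_left_mono) simp
        then show "\<bar>(a - b) \<bullet> ((1 / (s - t)) *\<^sub>R (P s - P t))\<bar>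
           \<le> 2 * ?e * norm ((1 / (s - t)) *\<^sub>R (P s - P t))"
          unfolding inner_scaleR_right norm_scaleR abs_mult by (simp only: mult_ac)
      qed
      have "\<bar>(a - b) \<bullet> v\<bar> \<le> 2 * ?e * norm v"
        by (rule tendsto_le[OF tr _ _ ev]) (intro tendsto_intros q)+
      moreover have "\<bar>(z - a) \<bullet> v\<bar> \<le> ?e * norm v"
        using Cauchy_Schwarz_ineq2[of "z - a" v] i(3) mult_right_mono[of "norm (z - a)" ?e "norm v"]
        by (simp add: dist_norm norm_minus_commute)
      moreover have "\<bar>(b - w) \<bullet> v\<bar> \<le> ?e * norm v"
        using Cauchy_Schwarz_ineq2[of "b - w" v] i(4) mult_right_mono[of "norm (b - w)" ?e "norm v"]
        by (simp add: dist_norm norm_minus_commute)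
      ultimately show ?thesis by (simp add: inner_diff_left)
    qed
    have "(\<lambda>n. 4 * (1 / real (Suc n)) * norm v) \<longlonglongrightarrow> 4 * 0 * norm v"
      by (intro tendsto_intros LIMSEQ_Suc[OF lim_1_over_n])
    then have "\<bar>(z - w) \<bullet> v\<bar> \<le> 4 * 0 * norm v"
      using est by (intro LIMSEQ_le_const) auto
    then show False using zw(3) by (simp add: inner_diff_left)
  qed
  ultimately show ?thesis by (rule countable_subset[rotated])
qed

end

section \<open>Convergence of Filippov solutions\<close>

context subgradient_cover
begin

context
  fixes S :: "'a set"
  assumes negligible_S: "negligible S"
begin

section \<open>Clarke's gradient as an upper semicontinuous set-valued map\<close>

definition gradient_graph :: "('a \<times> 'a) set" where
  "gradient_graph = {(x, g). x \<in> interior D - S \<and> GDERIV f x :> g}"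

abbreviation clarke :: "'a \<Rightarrow> 'a set" where
  "clarke \<equiv> generalized_gradient S D f"

lemma clarke_eq: "clarke x = convex hull {v. (x, v) \<in> closure gradient_graph}"
proof -
  have "(x, v) \<in> closure gradient_graph \<longleftrightarrow>
      (\<exists>y g. (\<forall>k::nat. y k \<in> interior D - S \<and> GDERIV f (y k) :> g k) \<and> y \<longlonglongrightarrow> x \<and> g \<longlonglongrightarrow> v)" for v
  proof
    assume "(x, v) \<in> closure gradient_graph"
    then obtain p where p: "\<And>k. p k \<in> gradient_graph" "p \<longlonglongrightarrow> (x, v)"
      unfolding closure_sequential by blast
    have "\<forall>k. fst (p k) \<in> interior D - S \<and> GDERIV f (fst (p k)) :> snd (p k)"
      using p(1) unfolding gradient_graph_def by (auto simp: case_prod_beta)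
    then show "\<exists>y g. (\<forall>k::nat. y k \<in> interior D - S \<and> GDERIV f (y k) :> g k) \<and> y \<longlonglongrightarrow> x \<and> g \<longlonglongrightarrow> v"
      using tendsto_fst[OF p(2)] tendsto_snd[OF p(2)] by fastforce
  next
    assume "\<exists>y g. (\<forall>k::nat. y k \<in> interior D - S \<and> GDERIV f (y k) :> g k) \<and> y \<longlonglongrightarrow> x \<and> g \<longlonglongrightarrow> v"
    then obtain y g where yg: "\<forall>k::nat. y k \<in> interior D - S \<and> GDERIV f (y k) :> g k"
      "y \<longlonglongrightarrow> x" "g \<longlonglongrightarrow> v" by blast
    then have "\<forall>k. (y k, g k) \<in> gradient_graph" by (simp add: gradient_graph_def)
    moreover have "(\<lambda>k. (y k, g k)) \<longlonglongrightarrow> (x, v)" using yg by (intro tendsto_Pair)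
    ultimately show "(x, v) \<in> closure gradient_graph" unfolding closure_sequential
      by (intro exI[of _ "\<lambda>k. (y k, g k)"]) simp
  qed
  then show ?thesis unfolding generalized_gradient_def by simp
qed

text \<open>The locale places only gradients at interior points in the cover; their limits follow
  because a finite union of compact graphs is closed.\<close>

lemma closure_gradient_graph_subset: "closure gradient_graph \<subseteq> \<Union>\<G>"
  using compact_imp_closed[OF compact_Union] gradient
  by (intro closure_minimal) (auto simp: gradient_graph_def)

lemma compact_closure_gradient_graph: "compact (closure gradient_graph)"
  using closure_gradient_graph_subset compact_Union
  by (metis closed_closure closed_Int_compact inf.absorb1)

lemma convex_clarke: "convex (clarke x)"
  unfolding clarke_eq by (rule convex_convex_hull)

lemma compact_clarke: "compact (clarke x)"
proof -
  have "compact (closure gradient_graph \<inter> {x} \<times> UNIV)"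
    by (intro compact_Int_closed compact_closure_gradient_graph closed_Times) auto
  then have "compact (snd ` (closure gradient_graph \<inter> {x} \<times> UNIV))"
    by (intro compact_continuous_image continuous_intros)
  moreover have "snd ` (closure gradient_graph \<inter> {x} \<times> UNIV) = {v. (x, v) \<in> closure gradient_graph}"
    by force
  ultimately show ?thesis unfolding clarke_eq by (simp add: compact_convex_hull)
qed

text \<open>On an empty set \<open>least_norm\<close> is an arbitrary value, so the vector field is
  meaningful only where Clarke's gradient is nonempty. Almost everywhere is enough, as
  \<open>filippov_map\<close> disregards null sets.\<close>

lemma clarke_nonempty_ae: "\<exists>N. negligible N \<and> (\<forall>x\<in>D - N. clarke x \<noteq> {})"
proof (intro exI conjI ballI)
  let ?M = "{x. \<exists>z w. (x, z) \<in> \<Union>\<G> \<and> (x, w) \<in> \<Union>\<G> \<and> z \<noteq> w}"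
  show "negligible (frontier D \<union> S \<union> ?M)"
    using negligible_convex_frontier[OF convex_D] negligible_S negligible_multiple_subgradients
    by (intro negligible_Un)
  fix x assume x: "x \<in> D - (frontier D \<union> S \<union> ?M)"
  then have xi: "x \<in> interior D" by (auto simp: frontier_def closure_def)
  obtain z where z: "(x, z) \<in> \<Union>\<G>" using cover x by blast
  have "GDERIV f x :> z"
    using x z by (intro differentiable_at_single_subgradient[OF xi]) blast
  then have "(x, z) \<in> gradient_graph" using x xi by (simp add: gradient_graph_def)
  then have "(x, z) \<in> closure gradient_graph" using closure_subset by blast
  then show "clarke x \<noteq> {}" unfolding clarke_eq using hull_inc by fastforce
qed

text \<open>Closed balls make this set closed as well as convex, so that it absorbs the hull in
  Clarke's gradient and the closed hull in \<open>filippov_map\<close>.\<close>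

definition clarke_nbhd :: "'a \<Rightarrow> real \<Rightarrow> 'a set" where
  "clarke_nbhd x e = (\<Union>u\<in>clarke x. \<Union>w\<in>cball 0 e. {u + w})"

lemma convex_clarke_nbhd: "convex (clarke_nbhd x e)"
  unfolding clarke_nbhd_def by (intro convex_sums convex_clarke convex_cball)

lemma closed_clarke_nbhd: "closed (clarke_nbhd x e)"
proof -
  have "clarke_nbhd x e = {u + w | u w. u \<in> clarke x \<and> w \<in> cball 0 e}"
    unfolding clarke_nbhd_def by blast
  then show ?thesis
    using compact_imp_closed[OF compact_sums[OF compact_clarke[of x] compact_cball[of 0 e]]] by metis
qed

lemma clarke_upper_semicontinuous:
  assumes "e > 0"
  shows "\<exists>d>0. \<forall>y\<in>ball x d. clarke y \<subseteq> clarke_nbhd x e"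
proof -
  obtain d where d: "d > 0" "\<And>y z. (y, z) \<in> closure gradient_graph \<Longrightarrow> dist y x < d \<Longrightarrow>
      \<exists>z'. (x, z') \<in> closure gradient_graph \<and> dist z z' < e"
    using compact_graph_upper_semicontinuous[OF compact_closure_gradient_graph assms] by metis
  have "clarke y \<subseteq> clarke_nbhd x e" if y: "y \<in> ball x d" for y
    unfolding clarke_eq[of y]
  proof (rule hull_minimal)
    show "{v. (y, v) \<in> closure gradient_graph} \<subseteq> clarke_nbhd x e"
    proof
      fix v assume "v \<in> {v. (y, v) \<in> closure gradient_graph}"
      then obtain z where z: "(x, z) \<in> closure gradient_graph" "dist v z < e"
        using d(2)[of y v] y by (auto simp: dist_commute)
      then have "z \<in> clarke x" unfolding clarke_eq by (intro hull_inc) simp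
      then show "v \<in> clarke_nbhd x e"
        unfolding clarke_nbhd_def using z(2)
        by (intro UN_I[of z] UN_I[of "v - z"]) (auto simp: dist_norm norm_minus_commute)
    qed
  qed (rule convex_clarke_nbhd)
  then show ?thesis using d(1) by blast
qed

lemma in_clarke_if_in_nbhds:
  assumes "\<And>e. e > 0 \<Longrightarrow> v \<in> clarke_nbhd x e"
  shows "v \<in> clarke x"
proof -
  have "\<exists>u\<in>clarke x. dist u v < e" if "e > 0" for e
  proof -
    have "v \<in> clarke_nbhd x (e / 2)" using assms that by simp
    then obtain u w where "u \<in> clarke x" "norm w \<le> e / 2" "v = u + w"
      unfolding clarke_nbhd_def by auto
    then show ?thesis using that by (intro bexI[of _ u]) (auto simp: dist_norm)
  qed
  then show ?thesis
    using closed_approachable[OF compact_imp_closed[OF compact_clarke]] by blast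
qed

text \<open>Near \<open>x\<close> and off a null set the field takes values in a rescaled
  \<open>clarke_nbhd\<close>, which is closed and convex and hence contains the Filippov set; then
  the radius shrinks to 0. Outside \<open>D\<close> the Filippov set is empty because some ball
  misses \<open>D\<close>.\<close>

lemma filippov_map_subset_clarke:
  assumes v: "v \<in> filippov_map D (\<lambda>x. \<sigma> *\<^sub>R least_norm (clarke x)) x" and \<sigma>: "\<sigma> * \<sigma> = 1"
  shows "x \<in> D \<and> \<sigma> *\<^sub>R v \<in> clarke x"
proof
  let ?X = "\<lambda>x. \<sigma> *\<^sub>R least_norm (clarke x)"
  have v': "v \<in> closure (convex hull (?X ` (ball x d \<inter> D - N)))" if "d > 0" "negligible N" for d N
    using v that unfolding filippov_map_def by auto
  show "x \<in> D"
  proof (rule ccontr)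
    assume "x \<notin> D"
    then obtain d where "d > 0" "ball x d \<subseteq> - D"
      using compact_imp_closed[OF compact_D] by (metis ComplI open_Compl open_contains_ball)
    then have "ball x d \<inter> D - {} = {}" by auto
    then show False using v'[OF \<open>d > 0\<close>, of "{}"] by simp
  qed
  obtain N where N: "negligible N" "\<And>y. y \<in> D - N \<Longrightarrow> clarke y \<noteq> {}"
    using clarke_nonempty_ae by blast
  show "\<sigma> *\<^sub>R v \<in> clarke x"
  proof (rule in_clarke_if_in_nbhds)
    fix e :: real assume "e > 0"
    then obtain d where d: "d > 0" "\<And>y. y \<in> ball x d \<Longrightarrow> clarke y \<subseteq> clarke_nbhd x e"
      using clarke_upper_semicontinuous by blast
    let ?C = "(*\<^sub>R) \<sigma> ` clarke_nbhd x e"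
    have "?X ` (ball x d \<inter> D - N) \<subseteq> ?C"
      using d(2) least_norm_in[OF compact_clarke N(2)] by fast
    then have "closure (convex hull (?X ` (ball x d \<inter> D - N))) \<subseteq> ?C"
      by (intro closure_minimal hull_minimal convex_scaling convex_clarke_nbhd closed_scaling closed_clarke_nbhd)
    then obtain u where "u \<in> clarke_nbhd x e" "v = \<sigma> *\<^sub>R u"
      using v'[OF d(1) N(1)] by blast
    then show "\<sigma> *\<^sub>R v \<in> clarke_nbhd x e" using \<sigma> by simp
  qed
qed

lemma clarke_bounded: "\<exists>B>0. \<forall>x. \<forall>z\<in>clarke x. norm z \<le> B"
proof -
  obtain B where B: "B > 0" "\<And>p. p \<in> closure gradient_graph \<Longrightarrow> norm p \<le> B"
    using compact_imp_bounded[OF compact_closure_gradient_graph] by (meson bounded_pos)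
  have "clarke x \<subseteq> cball 0 B" for x
    unfolding clarke_eq
  proof (rule hull_minimal)
    show "{v. (x, v) \<in> closure gradient_graph} \<subseteq> cball 0 B"
      using B(2) norm_snd_le order_trans by fastforce
  qed (rule convex_cball)
  then show ?thesis using B(1) by (auto simp: subset_iff)
qed

lemma clarke_inner_constant:
  assumes "\<And>z. (x, z) \<in> \<Union>\<G> \<Longrightarrow> z \<bullet> v = c" and "w \<in> clarke x"
  shows "w \<bullet> v = c"
proof -
  have "convex {z. z \<bullet> v = c}"
    using convex_hyperplane[of v c] by (simp add: inner_commute)
  then have "clarke x \<subseteq> {z. z \<bullet> v = c}"
    unfolding clarke_eq using closure_gradient_graph_subset assms(1)
    by (intro hull_minimal) auto
  then show ?thesis using assms(2) by blast
qed

text \<open>At a noncritical point of \<open>D\<close>, 0 has positive distance from the closed set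
  \<open>clarke x\<close>; upper semicontinuity makes half of it a local bound, and a finite
  subcover a uniform one. If there are no critical points, \<open>E\<close> is all of
  \<open>D\<close>.\<close>

lemma clarke_norm_bounded_below:
  assumes e: "e > 0"
  shows "\<exists>c>0. \<forall>x\<in>D. (\<forall>a\<in>critical_points S D f. e \<le> dist x a) \<longrightarrow> (\<forall>z\<in>clarke x. c \<le> norm z)"
proof -
  define E where "E = D \<inter> (\<Inter>a\<in>critical_points S D f. {x. e \<le> dist x a})"
  have "closed {x. e \<le> dist x a}" for a :: 'a by (intro closed_Collect_le continuous_intros)
  then have cE: "compact E" unfolding E_def by (intro compact_Int_closed compact_D closed_INT) auto
  have loc: "\<exists>d>0. \<exists>c>0. \<forall>y\<in>ball x d. \<forall>z\<in>clarke y. c \<le> norm z" if x: "x \<in> E" for x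
  proof -
    have "x \<notin> critical_points S D f" using x e by (auto simp: E_def)
    then have "0 \<notin> clarke x" using x by (auto simp: critical_points_def E_def)
    then obtain c where c: "c > 0" "ball 0 c \<subseteq> - clarke x"
      using compact_imp_closed[OF compact_clarke] by (metis ComplI open_Compl open_contains_ball)
    obtain d where d: "d > 0" "\<And>y. y \<in> ball x d \<Longrightarrow> clarke y \<subseteq> clarke_nbhd x (c / 2)"
      using clarke_upper_semicontinuous[of "c / 2" x] c by auto
    have "c / 2 \<le> norm z" if yz: "y \<in> ball x d" "z \<in> clarke y" for y z
    proof -
      obtain u w where uw: "u \<in> clarke x" "norm w \<le> c / 2" "z = u + w"
        using d(2)[OF yz(1)] yz(2) by (auto simp: clarke_nbhd_def)
      have "c \<le> norm u" using uw(1) c(2) by (force simp: subset_iff not_less[symmetric])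
      then show ?thesis using norm_diff_ineq[of u w] uw by simp
    qed
    then show ?thesis using d(1) c(1) by (meson half_gt_zero)
  qed
  then obtain d c where dc: "\<And>x. x \<in> E \<Longrightarrow> d x > 0" "\<And>x. x \<in> E \<Longrightarrow> c x > 0"
    "\<And>x y z. x \<in> E \<Longrightarrow> y \<in> ball x (d x) \<Longrightarrow> z \<in> clarke y \<Longrightarrow> c x \<le> norm z"
    by metis
  obtain F where F: "F \<subseteq> E" "finite F" "E \<subseteq> (\<Union>x\<in>F. ball x (d x))"
    proof (rule compactE_image[OF cE, of E "\<lambda>x. ball x (d x)"])
    show "E \<subseteq> (\<Union>x\<in>E. ball x (d x))" using dc(1) by auto
  qed auto
  define m where "m = Min (insert 1 (c ` F))"
  have "m > 0" using F dc(2) by (auto simp: m_def)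
  moreover have "m \<le> norm z" if xz: "x \<in> E" "z \<in> clarke x" for x z
  proof -
    obtain y where y: "y \<in> F" "x \<in> ball y (d y)" using F(3) xz(1) by blast
    then have "c y \<le> norm z" using dc(3) F(1) xz(2) by blast
    moreover have "m \<le> c y" using y(1) F(2) by (auto simp: m_def)
    ultimately show ?thesis by simp
  qed
  ultimately show ?thesis unfolding E_def by blast
qed

section \<open>Filippov solutions: invariance, rate of the objective and convergence\<close>

context
  fixes P :: "real \<Rightarrow> 'a" and \<sigma> :: real
  assumes sign: "\<sigma> * \<sigma> = 1"
    and solution: "filippov_solution D (\<lambda>x. \<sigma> *\<^sub>R least_norm (clarke x)) P"
begin

lemma abs_sign: "\<bar>\<sigma>\<bar> = 1"
  using sign by (auto simp: square_eq_1_iff)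

lemma solution_derivative_ae:
  "\<exists>N. negligible N \<and> (\<forall>t. 0 \<le> t \<longrightarrow> t \<notin> N \<longrightarrow>
     (\<exists>v. (P has_vector_derivative v) (at t) \<and> P t \<in> D \<and> \<sigma> *\<^sub>R v \<in> clarke (P t)))"
proof -
  have "AE t in lebesgue. 0 \<le> t \<longrightarrow>
     (\<exists>v. (P has_vector_derivative v) (at t) \<and> P t \<in> D \<and> \<sigma> *\<^sub>R v \<in> clarke (P t))"
    using solution filippov_map_subset_clarke[OF _ sign] unfolding filippov_solution_def
    by (auto elim!: eventually_mono)
  then show ?thesis
    by (auto elim!: AE_E3 simp: negligible_iff_null_sets)
qed

lemma solution_absolutely_continuous: "0 \<le> a \<Longrightarrow> 0 \<le> b \<Longrightarrow> absolutely_continuous_curve {a..b} P"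
  using solution unfolding filippov_solution_def
  by (metis absolutely_continuous_curve_subset atLeastatMost_subset_iff order_refl)

text \<open>A nonempty Filippov set places the solution in \<open>D\<close> at almost every time;
  continuity and closedness of \<open>D\<close> extend this to all times.\<close>

lemma solution_in_domain:
  assumes t: "0 \<le> t"
  shows "P t \<in> D"
proof (rule ccontr)
  assume nD: "P t \<notin> D"
  obtain N where N: "negligible N" "\<And>s. 0 \<le> s \<Longrightarrow> s \<notin> N \<Longrightarrow> P s \<in> D"
    using solution_derivative_ae by blast
  have c: "continuous_on {0..t + 1} P"
    using t by (intro absolutely_continuous_curve_continuous solution_absolutely_continuous) auto
  obtain e where e: "e > 0" "ball (P t) e \<subseteq> - D"
    using nD compact_imp_closed[OF compact_D] by (metis ComplI open_Compl open_contains_ball)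
  then obtain d where d: "d > 0" "\<And>s. s \<in> {0..t + 1} \<Longrightarrow> dist s t < d \<Longrightarrow> dist (P s) (P t) < e"
    using c t unfolding continuous_on_iff by (metis add_increasing2 atLeastAtMost_iff le_add_same_cancel1 zero_le_one)
  have "{t<..<t + min d 1} \<subseteq> N"
  proof
    fix s assume s: "s \<in> {t<..<t + min d 1}"
    then have "dist (P s) (P t) < e" using t by (intro d(2)) (auto simp: dist_real_def)
    then have "P s \<notin> D" using e(2) by (auto simp: dist_commute)
    then show "s \<in> N" using N(2)[of s] s t by auto
  qed
  then have "negligible {t<..<t + min d 1}" using N(1) negligible_subset by blast
  then show False using d(1) open_not_negligible[of "{t<..<t + min d 1}"] by simp
qed

text \<open>Since \<open>\<sigma> *\<^sub>R v\<close> is itself a generalized gradient, and all of them have the same inner product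
  with \<open>v\<close>, the chain rule gives the rate \<open>\<sigma> * (norm v)\<^sup>2\<close> for \<open>f\<close>.\<close>

lemma solution_rate_ae:
  "\<exists>N. negligible N \<and> (\<forall>t. 0 \<le> t \<longrightarrow> t \<notin> N \<longrightarrow>
     (\<exists>v. (P has_vector_derivative v) (at t) \<and> \<sigma> *\<^sub>R v \<in> clarke (P t) \<and>
        ((\<lambda>s. - \<sigma> * f (P s)) has_real_derivative - (norm v)\<^sup>2) (at t within {0..})))"
proof -
  obtain N where N: "negligible N" "\<And>t. 0 \<le> t \<Longrightarrow> t \<notin> N \<Longrightarrow>
     (\<exists>v. (P has_vector_derivative v) (at t) \<and> P t \<in> D \<and> \<sigma> *\<^sub>R v \<in> clarke (P t))"
    using solution_derivative_ae by blast
  let ?M = "{t. \<exists>v z w. (P has_vector_derivative v) (at t) \<and> (P t, z) \<in> \<Union>\<G> \<and> (P t, w) \<in> \<Union>\<G> \<and> z \<bullet> v \<noteq> w \<bullet> v}"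
  have neg: "negligible (N \<union> ?M)"
    using N(1) countable_imp_null_set_lborel[OF countable_ambiguous_times[of P]]
    by (intro negligible_Un) (auto simp: negligible_iff_null_sets null_sets_completionI)
  have "\<exists>v. (P has_vector_derivative v) (at t) \<and> \<sigma> *\<^sub>R v \<in> clarke (P t) \<and>
        ((\<lambda>s. - \<sigma> * f (P s)) has_real_derivative - (norm v)\<^sup>2) (at t within {0..})"
    if t: "0 \<le> t" "t \<notin> N \<union> ?M" for t
  proof -
    obtain v where v: "(P has_vector_derivative v) (at t)" "P t \<in> D" "\<sigma> *\<^sub>R v \<in> clarke (P t)"
      using N(2) t by blast
    obtain z0 where z0: "(P t, z0) \<in> \<Union>\<G>" using cover v(2) by blast
    have single: "z \<bullet> v = z0 \<bullet> v" if "(P t, z) \<in> \<Union>\<G>" for z using t(2) v(1) z0 that by blast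
    have "\<sigma> *\<^sub>R v \<bullet> v = z0 \<bullet> v" using clarke_inner_constant[OF single v(3)] .
    then have z0v: "z0 \<bullet> v = \<sigma> * (norm v)\<^sup>2" by (simp add: power2_norm_eq_inner)
    have "((\<lambda>s. f (P s)) has_derivative (\<lambda>h. h * (\<sigma> * (norm v)\<^sup>2))) (at t within {0..})"
    proof (rule chain_rule)
      show "(P has_derivative (\<lambda>h. h *\<^sub>R v)) (at t within {0..})"
        using has_vector_derivative_at_within[OF v(1)] by (simp add: has_vector_derivative_def)
    qed (use t single z0v solution_in_domain in auto)
    then have "((\<lambda>s. f (P s)) has_real_derivative \<sigma> * (norm v)\<^sup>2) (at t within {0..})"
      by (simp add: has_field_derivative_def mult.commute[of _ "\<sigma> * (norm v)\<^sup>2"] )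
    then have "((\<lambda>s. - \<sigma> * f (P s)) has_real_derivative - \<sigma> * (\<sigma> * (norm v)\<^sup>2)) (at t within {0..})"
      by (rule DERIV_cmult)
    moreover have "- \<sigma> * (\<sigma> * (norm v)\<^sup>2) = - (norm v)\<^sup>2"
      using sign by (simp add: mult.assoc[symmetric])
    ultimately show ?thesis using v by metis
  qed
  then show ?thesis using neg by blast
qed

text \<open>The velocity is up to sign a generalized gradient, so \<open>c\<close> bounds its
  squared norm and thereby the rate from \<open>solution_rate_ae\<close>. The case
  \<open>c = 0\<close> gives monotonicity.\<close>

lemma objective_decrease:
  assumes "0 \<le> a" "a \<le> b" and c: "\<And>t z. t \<in> {a..b} \<Longrightarrow> z \<in> clarke (P t) \<Longrightarrow> c \<le> (norm z)\<^sup>2"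
  shows "- \<sigma> * f (P b) \<le> - \<sigma> * f (P a) - c * (b - a)"
proof -
  obtain N where N: "negligible N" "\<And>t. 0 \<le> t \<Longrightarrow> t \<notin> N \<Longrightarrow>
     (\<exists>v. (P has_vector_derivative v) (at t) \<and> \<sigma> *\<^sub>R v \<in> clarke (P t) \<and>
        ((\<lambda>s. - \<sigma> * f (P s)) has_real_derivative - (norm v)\<^sup>2) (at t within {0..}))"
    using solution_rate_ae by blast
  have "absolutely_continuous_curve {a..b} (\<lambda>t. - \<sigma> * f (P t))"
  proof (rule absolutely_continuous_curve_lipschitz[OF solution_absolutely_continuous, where L = L])
    fix s t
    have "norm (- \<sigma> * f (P s) - - \<sigma> * f (P t)) = \<bar>\<sigma>\<bar> * \<bar>f (P s) - f (P t)\<bar>"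
      by (simp add: abs_mult[symmetric] right_diff_distrib abs_minus_commute)
    also have "\<dots> \<le> L * norm (P s - P t)"
      using lipschitz_onD[OF lipschitz, of "P s" "P t"] abs_sign by (simp add: dist_norm)
    finally show "norm (- \<sigma> * f (P s) - - \<sigma> * f (P t)) \<le> L * norm (P s - P t)" .
  qed (use assms in auto)
  then have "- \<sigma> * f (P b) - - \<sigma> * f (P a) \<le> - c * (b - a)"
  proof (rule absolutely_continuous_growth[OF _ assms(2) N(1)])
    fix t assume t: "t \<in> {a..b} - N"
    then obtain v where v: "\<sigma> *\<^sub>R v \<in> clarke (P t)"
        "((\<lambda>s. - \<sigma> * f (P s)) has_real_derivative - (norm v)\<^sup>2) (at t within {0..})"
      using N(2)[of t] assms(1) by auto
    have "c \<le> (norm v)\<^sup>2" using c[OF _ v(1)] t abs_sign by simp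
    moreover have "((\<lambda>s. - \<sigma> * f (P s)) has_real_derivative - (norm v)\<^sup>2) (at t within {a..b})"
      using DERIV_subset[OF v(2), of "{a..b}"] assms(1) by auto
    ultimately show "\<exists>d\<le>- c. ((\<lambda>s. - \<sigma> * f (P s)) has_real_derivative d) (at t within {a..b})"
      by (intro exI[of _ "- (norm v)\<^sup>2"]) simp
  qed
  then show ?thesis by simp
qed

text \<open>Testing against the increment \<open>w\<close> itself reduces the vector estimate to the
  scalar growth lemma; a factor \<open>norm w\<close> then cancels.\<close>

lemma solution_lipschitz:
  assumes B: "\<And>x z. z \<in> clarke x \<Longrightarrow> norm z \<le> B" and "0 \<le> B" and ab: "0 \<le> a" "a \<le> b"
  shows "norm (P b - P a) \<le> B * (b - a)"
proof -
  obtain N where N: "negligible N" "\<And>t. 0 \<le> t \<Longrightarrow> t \<notin> N \<Longrightarrow>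
     (\<exists>v. (P has_vector_derivative v) (at t) \<and> P t \<in> D \<and> \<sigma> *\<^sub>R v \<in> clarke (P t))"
    using solution_derivative_ae by blast
  define w where "w = P b - P a"
  have "absolutely_continuous_curve {a..b} (\<lambda>t. w \<bullet> P t)"
  proof (rule absolutely_continuous_curve_lipschitz[OF solution_absolutely_continuous])
    show "norm (w \<bullet> P s - w \<bullet> P t) \<le> norm w * norm (P s - P t)" for s t
      using Cauchy_Schwarz_ineq2[of w "P s - P t"] by (simp add: inner_diff_right)
  qed (use ab in auto)
  then have "w \<bullet> P b - w \<bullet> P a \<le> (norm w * B) * (b - a)"
  proof (rule absolutely_continuous_growth[OF _ ab(2) N(1)])
    fix t assume t: "t \<in> {a..b} - N"
    then obtain v where v: "(P has_vector_derivative v) (at t)" "\<sigma> *\<^sub>R v \<in> clarke (P t)"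
      using N(2)[of t] ab(1) by auto
    have "((\<lambda>s. w \<bullet> P s) has_real_derivative w \<bullet> v) (at t within {a..b})"
      using bounded_linear.has_vector_derivative[OF bounded_linear_inner_right has_vector_derivative_at_within[OF v(1)]]
      by (simp add: has_real_derivative_iff_has_vector_derivative)
    moreover have "w \<bullet> v \<le> norm w * B"
      using norm_cauchy_schwarz[of w v] B[OF v(2)] abs_sign mult_left_mono[of "norm v" B "norm w"] by simp
    ultimately show "\<exists>d\<le>norm w * B. ((\<lambda>s. w \<bullet> P s) has_real_derivative d) (at t within {a..b})" by blast
  qed
  then have "norm w * norm w \<le> norm w * (B * (b - a))"
    by (simp add: w_def inner_diff_right[symmetric] power2_norm_eq_inner[symmetric] power2_eq_square mult.assoc)
  moreover have "0 \<le> B * (b - a)" using assms by simp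
  ultimately show ?thesis by (cases "w = 0") (auto simp: w_def)
qed

theorem solution_converges: "converges_to_set P (critical_points S D f)"
  unfolding converges_to_set_def
proof (intro allI impI)
  fix e :: real assume e: "e > 0"
  let ?C = "critical_points S D f"
  obtain B where B: "B > 0" "\<And>x z. z \<in> clarke x \<Longrightarrow> norm z \<le> B" using clarke_bounded by blast
  have "e / 2 > 0" using e by simp
  then obtain c where c: "c > 0"
    "\<And>x z. x \<in> D \<Longrightarrow> (\<And>a. a \<in> ?C \<Longrightarrow> e / 2 \<le> dist x a) \<Longrightarrow> z \<in> clarke x \<Longrightarrow> c \<le> norm z"
    using clarke_norm_bounded_below by metis
  \<comment> \<open>In time \<open>h\<close> a solution of speed at most \<open>B\<close> moves by
    at most \<open>e / 2\<close>, so a point at distance \<open>e\<close> from the critical points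
    stays at distance \<open>e / 2\<close> for that long.\<close>
  define h where "h = e / (2 * B)"
  have h: "h > 0" "B * h = e / 2" using e B by (auto simp: h_def)
  define \<phi> where "\<phi> t = - \<sigma> * f (P t)" for t
  have mono: "\<phi> t \<le> \<phi> s" if "0 \<le> s" "s \<le> t" for s t
    using objective_decrease[OF that, of 0] by (simp add: \<phi>_def)
  have drop: "\<phi> (t + h) \<le> \<phi> t - c\<^sup>2 * h" if t: "0 \<le> t" "\<And>a. a \<in> ?C \<Longrightarrow> e \<le> dist (P t) a" for t
  proof -
    have "c\<^sup>2 \<le> (norm z)\<^sup>2" if s: "s \<in> {t..t + h}" "z \<in> clarke (P s)" for s z
    proof (rule power_mono)
      have "dist (P t) (P s) \<le> B * (s - t)"
        using solution_lipschitz[of B t s] B s t(1) by (simp add: dist_norm norm_minus_commute)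
      also have "\<dots> \<le> B * h" using s B(1) by (intro mult_left_mono) auto
      finally have *: "dist (P t) (P s) \<le> e / 2" using h by simp
      show "c \<le> norm z"
      proof (rule c(2)[OF _ _ s(2)])
        show "P s \<in> D" using s t by (intro solution_in_domain) auto
        show "e / 2 \<le> dist (P s) a" if "a \<in> ?C" for a
          using t(2)[OF that] * dist_triangle[of "P t" a "P s"] by simp
      qed
    qed (use c in auto)
    then show ?thesis
      using objective_decrease[of t "t + h" "c\<^sup>2"] t(1) h(1) by (simp add: \<phi>_def)
  qed
  have "compact (f ` D)"
    using lipschitz_on_continuous_on[OF lipschitz] compact_D
    by (intro compact_continuous_image) (auto intro: continuous_on_subset)
  then obtain M where M: "\<And>x. x \<in> D \<Longrightarrow> \<bar>f x\<bar> \<le> M"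
    using compact_imp_bounded bounded_iff by (metis imageI real_norm_def)
  have bdd: "bdd_below (\<phi> ` {0..})"
  proof (rule bdd_belowI2[where m = "- M"])
    fix t :: real assume "t \<in> {0..}"
    then have "\<bar>\<phi> t\<bar> \<le> M" using M[OF solution_in_domain[of t]] abs_sign by (simp add: \<phi>_def abs_mult)
    then show "- M \<le> \<phi> t" by linarith
  qed
  \<comment> \<open>Once \<open>\<phi>\<close> is within \<open>c\<^sup>2 * h\<close> of its
    infimum, there is no room for another drop, so excursions need not be counted.\<close>
  have "(INF t\<in>{0..}. \<phi> t) < (INF t\<in>{0..}. \<phi> t) + c\<^sup>2 * h" using c h by simp
  moreover have "{0::real..} \<noteq> {}" by (metis atLeast_iff empty_iff order_refl)
  ultimately have "\<exists>T\<in>{0..}. \<phi> T < (INF t\<in>{0..}. \<phi> t) + c\<^sup>2 * h"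
    using cINF_less_iff[OF _ bdd] by blast
  then obtain T where T: "0 \<le> T" "\<phi> T < (INF t\<in>{0..}. \<phi> t) + c\<^sup>2 * h" by auto
  have "\<exists>a\<in>?C. dist (P t) a < e" if t: "T \<le> t" for t
  proof (rule ccontr)
    assume "\<not> ?thesis"
    then have "\<phi> (t + h) \<le> \<phi> t - c\<^sup>2 * h" using T t by (intro drop) (auto simp: not_less)
    also have "\<phi> t \<le> \<phi> T" using mono T t by blast
    also have "\<phi> T < (INF t\<in>{0..}. \<phi> t) + c\<^sup>2 * h" by (rule T)
    also have "(INF t\<in>{0..}. \<phi> t) \<le> \<phi> (t + h)" using T t h bdd by (intro cINF_lower) auto
    finally show False by simp
  qed
  then show "\<forall>\<^sub>F t in at_top. \<exists>a\<in>?C. dist (P t) a < e"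
    unfolding eventually_at_top_linorder by blast
qed

end

end

end

section \<open>The sphere-packing function\<close>

lemma gradient_directional_tendsto:
  assumes "GDERIV f x :> g"
  shows "((\<lambda>s. (f (x + s *\<^sub>R h) - f x) / s) \<longlongrightarrow> g \<bullet> h) (at_right 0)"
proof -
  have "((\<lambda>s. x + s *\<^sub>R h) has_derivative (\<lambda>s. s *\<^sub>R h)) (at (0 :: real))"
    by (auto intro!: derivative_eq_intros)
  moreover have "(f has_derivative (\<lambda>h. h \<bullet> g)) (at (x + 0 *\<^sub>R h))"
    using assms by (simp add: gderiv_def)
  ultimately have "((\<lambda>s. f (x + s *\<^sub>R h)) has_derivative (\<lambda>s. (s *\<^sub>R h) \<bullet> g)) (at 0)"
    by (rule has_derivative_compose)
  then have "((\<lambda>s. f (x + s *\<^sub>R h)) has_real_derivative g \<bullet> h) (at 0)"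
    by (simp add: has_field_derivative_def inner_commute mult.commute[of _ "g \<bullet> h"])
  then show ?thesis
    using filterlim_mono[OF _ order_refl at_le[OF subset_UNIV]] by (fastforce simp: DERIV_def)
qed

lemma gradient_norm_le_lipschitz:
  assumes "GDERIV f x :> g" and lip: "L-lipschitz_on UNIV f"
  shows "norm g \<le> L"
proof -
  have "eventually (\<lambda>s. (f (x + s *\<^sub>R g) - f x) / s \<le> L * norm g) (at_right 0)"
    unfolding eventually_at_filter
  proof (intro always_eventually allI impI)
    fix s :: real assume "s \<in> {0<..}"
    then show "(f (x + s *\<^sub>R g) - f x) / s \<le> L * norm g"
      using lipschitz_onD[OF lip, of "x + s *\<^sub>R g" x]
      by (simp add: dist_norm divide_le_eq mult_ac)
  qed
  then have "g \<bullet> g \<le> L * norm g"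
    by (intro tendsto_upperbound[OF gradient_directional_tendsto[OF assms(1), of g]]) auto
  then have "norm g * norm g \<le> L * norm g" by (simp add: norm_eq_sqrt_inner)
  then show ?thesis
    using lipschitz_on_nonneg[OF lip] by (cases "norm g = 0") (auto simp: mult_le_cancel_right)
qed

text \<open>Subgradients relative to a subset can be unbounded; on a singleton every vector is one.
  The bound \<open>L\<close> is what makes the graph compact.\<close>

definition subgradient_graph :: "('a::euclidean_space \<Rightarrow> real) \<Rightarrow> real \<Rightarrow> 'a set \<Rightarrow> ('a \<times> 'a) set" where
  "subgradient_graph f L A = {(x, z). x \<in> A \<and> norm z \<le> L \<and> (\<forall>y\<in>A. f x + z \<bullet> (y - x) \<le> f y)}"

lemma compact_subgradient_graph:
  assumes A: "compact A" and f: "continuous_on UNIV f"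
  shows "compact (subgradient_graph f L A)"
proof -
  have "closed {p :: 'a \<times> 'a. f (fst p) + snd p \<bullet> (y - fst p) \<le> f y}" for y
    by (intro closed_Collect_le continuous_intros continuous_on_compose2[OF f]) auto
  then have "compact (A \<times> cball 0 L \<inter> (\<Inter>y\<in>A. {p. f (fst p) + snd p \<bullet> (y - fst p) \<le> f y}))"
    by (intro compact_Int_closed compact_Times A compact_cball closed_INT) auto
  moreover have "A \<times> cball 0 L \<inter> (\<Inter>y\<in>A. {p. f (fst p) + snd p \<bullet> (y - fst p) \<le> f y})
      = subgradient_graph f L A"
    by (auto simp: subgradient_graph_def)
  ultimately show ?thesis by simp
qed

lemma subgradient_coverI:
  assumes "compact D" "convex D" and lip: "L-lipschitz_on UNIV f"
    and "finite \<A>" and comp: "\<And>A. A \<in> \<A> \<Longrightarrow> compact A"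
    and sub: "\<And>x. x \<in> D \<Longrightarrow> \<exists>A\<in>\<A>. x \<in> A \<and> (\<exists>z. norm z \<le> L \<and> (\<forall>y\<in>A. f x + z \<bullet> (y - x) \<le> f y))"
    and grad: "\<And>x g. x \<in> interior D \<Longrightarrow> GDERIV f x :> g \<Longrightarrow>
        \<exists>A\<in>\<A>. x \<in> A \<and> (\<forall>y\<in>A. f x + g \<bullet> (y - x) \<le> f y)"
  shows "subgradient_cover D f L (subgradient_graph f L ` \<A>)"
proof
  show "G \<in> subgradient_graph f L ` \<A> \<Longrightarrow> compact G" for G
    using compact_subgradient_graph[OF comp lipschitz_on_continuous_on[OF lip]] by blast
  show "f x + z \<bullet> (y - x) \<le> f y"
    if "G \<in> subgradient_graph f L ` \<A>" "(x, z) \<in> G" "(y, w) \<in> G" for G x y z w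
    using that by (auto simp: subgradient_graph_def)
  show "\<exists>z. (x, z) \<in> \<Union> (subgradient_graph f L ` \<A>)" if x: "x \<in> D" for x
    using sub[OF x] by (auto simp: subgradient_graph_def)
  show "(x, g) \<in> \<Union> (subgradient_graph f L ` \<A>)" if "x \<in> interior D" "GDERIV f x :> g" for x g
    using grad[OF that] gradient_norm_le_lipschitz[OF that(2) lip]
    by (auto simp: subgradient_graph_def)
qed (use assms in auto)

lemma convex_on_if_subgradients:
  fixes h :: "'a::real_inner \<Rightarrow> real"
  assumes "\<And>x. \<exists>z. \<forall>y. h x + z \<bullet> (y - x) \<le> h y"
  shows "convex_on UNIV h"
proof (intro convex_onI)
  fix t :: real and x y :: 'a assume t: "0 < t" "t < 1"
  let ?w = "(1 - t) *\<^sub>R x + t *\<^sub>R y"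
  obtain z where z: "\<And>y. h ?w + z \<bullet> (y - ?w) \<le> h y" using assms by blast
  have "(1 - t) * (h ?w + z \<bullet> (x - ?w)) + t * (h ?w + z \<bullet> (y - ?w)) \<le> (1 - t) * h x + t * h y"
    using z[of x] z[of y] t by (intro add_mono mult_left_mono) auto
  moreover have "(1 - t) * (z \<bullet> (x - ?w)) + t * (z \<bullet> (y - ?w)) = 0"
    by (simp add: inner_diff_right inner_add_right algebra_simps)
  ultimately show "h ?w \<le> (1 - t) * h x + t * h y" by (simp add: algebra_simps)
qed simp

text \<open>Bounded subgradients everywhere encode both facts used about each \<open>h\<close>:
  convexity and the Lipschitz constant \<open>L\<close>. On the set where \<open>h = f\<close>, the
  subgradients of \<open>h\<close> serve for \<open>f\<close>.\<close>

lemma subgradient_cover_Min: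
  fixes \<H> :: "('a::euclidean_space \<Rightarrow> real) set"
  assumes D: "compact D" "convex D" and \<H>: "finite \<H>" "\<H> \<noteq> {}" and L: "0 \<le> L"
    and sub: "\<And>h x. h \<in> \<H> \<Longrightarrow> \<exists>z. norm z \<le> L \<and> (\<forall>y. h x + z \<bullet> (y - x) \<le> h y)"
    and f: "\<And>x. f x = Min ((\<lambda>h. h x) ` \<H>)"
  shows "\<exists>\<G>. subgradient_cover D f L \<G>"
proof -
  have f_le: "f x \<le> h x" if "h \<in> \<H>" for h x unfolding f using \<H> that by simp
  have f_eq: "\<exists>h\<in>\<H>. f x = h x" for x
  proof -
    have "Min ((\<lambda>h. h x) ` \<H>) \<in> (\<lambda>h. h x) ` \<H>" using \<H> by (intro Min_in) auto
    then show ?thesis unfolding f by blast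
  qed
  have h_lip: "h x - h y \<le> L * norm (x - y)" if h: "h \<in> \<H>" for h x y
  proof -
    obtain z where z: "norm z \<le> L" "h x + z \<bullet> (y - x) \<le> h y" using sub[OF h] by blast
    have "h x - h y \<le> z \<bullet> (x - y)" using z(2) by (simp add: inner_diff_right)
    also have "\<dots> \<le> norm z * norm (x - y)" by (rule norm_cauchy_schwarz)
    also have "\<dots> \<le> L * norm (x - y)" using z(1) by (intro mult_right_mono) auto
    finally show ?thesis .
  qed
  have f_lip: "f x - f y \<le> L * norm (x - y)" for x y
    using f_eq[of y] f_le h_lip by (metis add_diff_cancel_left' diff_mono dual_order.trans order_refl)
  have lip: "L-lipschitz_on UNIV f"
    using f_lip L by (intro lipschitz_onI) (auto simp: dist_norm abs_le_iff, metis norm_minus_commute)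
  have cont: "continuous_on UNIV h" if "h \<in> \<H>" for h
    using h_lip[OF that] L by (intro lipschitz_on_continuous_on[of L] lipschitz_onI)
      (auto simp: dist_norm abs_le_iff, metis norm_minus_commute)
  have "subgradient_cover D f L (subgradient_graph f L ` (\<lambda>h. {x \<in> D. h x = f x}) ` \<H>)"
  proof (rule subgradient_coverI[OF D lip])
    show "finite ((\<lambda>h. {x \<in> D. h x = f x}) ` \<H>)" using \<H> by simp
    show "compact A" if A: "A \<in> (\<lambda>h. {x \<in> D. h x = f x}) ` \<H>" for A
    proof -
      obtain h where h: "h \<in> \<H>" "A = D \<inter> {x. h x = f x}" using A by auto
      show ?thesis unfolding h
        by (intro compact_Int_closed D closed_Collect_eq cont h lipschitz_on_continuous_on[OF lip])
    qed
    show "\<exists>A\<in>(\<lambda>h. {x \<in> D. h x = f x}) ` \<H>. x \<in> A \<and> (\<exists>z. norm z \<le> L \<and> (\<forall>y\<in>A. f x + z \<bullet> (y - x) \<le> f y))"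
      if x: "x \<in> D" for x
    proof -
      obtain h where h: "h \<in> \<H>" "f x = h x" using f_eq by blast
      obtain z where "norm z \<le> L" "\<forall>y. h x + z \<bullet> (y - x) \<le> h y" using sub[OF h(1)] by blast
      then have "\<exists>z. norm z \<le> L \<and> (\<forall>y\<in>{x \<in> D. h x = f x}. f x + z \<bullet> (y - x) \<le> f y)"
        using h(2) by (intro exI[of _ z]) (metis (mono_tags, lifting) mem_Collect_eq)
      then show ?thesis using x h by (intro bexI[of _ "{x \<in> D. h x = f x}"]) auto
    qed
    show "\<exists>A\<in>(\<lambda>h. {x \<in> D. h x = f x}) ` \<H>. x \<in> A \<and> (\<forall>y\<in>A. f x + g \<bullet> (y - x) \<le> f y)"
      if x: "x \<in> interior D" and g: "GDERIV f x :> g" for x g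
    proof -
      obtain h where h: "h \<in> \<H>" "f x = h x" using f_eq by blast
      have cvx: "convex_on UNIV h" using sub[OF h(1)] by (intro convex_on_if_subgradients) blast
      \<comment> \<open>As \<open>f \<le> h\<close> with equality at \<open>x\<close>, the gradient of \<open>f\<close> is a subgradient of \<open>h\<close>.\<close>
      have "f x + g \<bullet> (y - x) \<le> h y" for y
      proof -
        have "eventually (\<lambda>s. (f (x + s *\<^sub>R (y - x)) - f x) / s \<le> h y - h x) (at_right 0)"
          using eventually_at_right_real[of 0 1]
        proof (rule eventually_mono)
          fix s :: real assume "s \<in> {0<..<1}"
          then have s: "0 < s" "s < 1" by auto
          have "f (x + s *\<^sub>R (y - x)) \<le> h (x + s *\<^sub>R (y - x))" by (rule f_le[OF h(1)])
          also have "x + s *\<^sub>R (y - x) = (1 - s) *\<^sub>R x + s *\<^sub>R y" by (simp add: algebra_simps)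
          also have "h \<dots> \<le> (1 - s) * h x + s * h y" using s by (intro convex_onD[OF cvx]) auto
          finally have "f (x + s *\<^sub>R (y - x)) - f x \<le> (h y - h x) * s"
            using h(2) by (simp add: algebra_simps)
          then show "(f (x + s *\<^sub>R (y - x)) - f x) / s \<le> h y - h x"
            using s by (simp add: divide_le_eq)
        qed simp
        then have "g \<bullet> (y - x) \<le> h y - h x"
          by (intro tendsto_upperbound[OF gradient_directional_tendsto[OF g]]) auto
        then show ?thesis using h(2) by simp
      qed
      then have "\<forall>y\<in>{x \<in> D. h x = f x}. f x + g \<bullet> (y - x) \<le> f y"
        by (metis (mono_tags, lifting) mem_Collect_eq)
      moreover have "x \<in> {x \<in> D. h x = f x}" using h x interior_subset by auto
      ultimately show ?thesis using h(1) by blast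
    qed
  qed
  then show ?thesis by blast
qed

section \<open>Subgradients of norms and of distances to convex sets\<close>

lemma norm_axis:
  fixes u :: "'a::real_inner"
  shows "norm (axis i u) = norm u"
  by (simp only: norm_eq_sqrt_inner inner_axis' axis_nth)

text \<open>Cauchy-Schwarz; as \<open>sgn 0 = 0\<close>, the formula covers the origin too.\<close>

lemma norm_subgradient:
  fixes x :: "'a::real_inner"
  shows "norm x + sgn x \<bullet> (y - x) \<le> norm y"
proof -
  have "sgn x \<bullet> x = norm x"
    by (cases "x = 0") (simp_all add: sgn_div_norm power2_norm_eq_inner[symmetric] power2_eq_square)
  moreover have "sgn x \<bullet> y \<le> norm y"
    using norm_cauchy_schwarz[of "sgn x" y] by (cases "x = 0") (auto simp: norm_sgn)
  ultimately show ?thesis by (simp add: inner_diff_right)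
qed

text \<open>The subgradient is the unit vector from the nearest point \<open>q\<close> to
  \<open>p\<close>. The obtuse angle at \<open>q\<close> allows comparison with the nearest point
  \<open>r\<close> of \<open>y\<close>.\<close>

lemma infdist_subgradient:
  fixes p :: "'a::euclidean_space"
  assumes "convex C" "closed C" "C \<noteq> {}"
  shows "\<exists>u. norm u \<le> 1 \<and> (\<forall>y. infdist p C + u \<bullet> (y - p) \<le> infdist y C)"
proof -
  obtain q where q: "q \<in> C" "infdist p C = dist p q"
    using infdist_attains_inf[OF assms(2,3)] by metis
  have closest: "\<forall>z\<in>C. dist p q \<le> dist p z" using q infdist_le by metis
  have "infdist p C + sgn (p - q) \<bullet> (y - p) \<le> infdist y C" for y
  proof -
    obtain r where r: "r \<in> C" "infdist y C = dist y r"
      using infdist_attains_inf[OF assms(2,3)] by metis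
    have "(p - q) \<bullet> (r - q) \<le> 0" using any_closest_point_dot[OF assms(1,2) q(1) r(1) closest] .
    then have "sgn (p - q) \<bullet> (r - q) \<le> 0"
      by (simp add: sgn_div_norm mult_nonneg_nonpos)
    moreover have "norm (p - q) + sgn (p - q) \<bullet> ((y - r) - (p - q)) \<le> norm (y - r)"
      by (rule norm_subgradient)
    ultimately show ?thesis by (simp add: q r dist_norm inner_diff_right)
  qed
  moreover have "norm (sgn (p - q)) \<le> 1" by (simp add: norm_sgn)
  ultimately show ?thesis by blast
qed

lemma convex_configurations: "convex Q \<Longrightarrow> convex (configurations Q)"
  unfolding convex_def configurations_def by simp

lemma compact_configurations:
  assumes "compact Q"
  shows "compact (configurations Q :: ((real^2)^'n) set)"
proof -
  have "closed {P :: (real^2)^'n. P $ i \<in> Q}" for i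
    using compact_imp_closed[OF assms] continuous_closed_vimage[of Q "\<lambda>P. P $ i"]
    by (simp add: vimage_def continuous_intros)
  moreover have "configurations Q = (\<Inter>i. {P :: (real^2)^'n. P $ i \<in> Q})"
    by (auto simp: configurations_def)
  ultimately have "closed (configurations Q :: ((real^2)^'n) set)" by auto
  moreover obtain B where B: "\<And>q. q \<in> Q \<Longrightarrow> norm q \<le> B"
    using compact_imp_bounded[OF assms] by (auto simp: bounded_iff)
  have "norm P \<le> of_nat CARD('n) * B" if "P \<in> configurations Q" for P :: "(real^2)^'n"
  proof -
    have "norm P \<le> (\<Sum>i\<in>UNIV. norm (P $ i))"
      unfolding norm_vec_def by (rule L2_set_le_sum) simp
    also have "\<dots> \<le> (\<Sum>i\<in>(UNIV :: 'n set). B)"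
      using that B by (intro sum_mono) (auto simp: configurations_def)
    finally show ?thesis by simp
  qed
  then have "bounded (configurations Q :: ((real^2)^'n) set)" by (auto simp: bounded_iff)
  ultimately show ?thesis by (simp add: compact_eq_bounded_closed)
qed

lemma H_SP_subgradient_cover:
  assumes Q: "convex_polygon Q"
  shows "\<exists>\<G>. subgradient_cover (configurations Q) (H_SP Q :: (real^2)^'n \<Rightarrow> real) 1 \<G>"
proof -
  have pQ: "polytope Q" "aff_dim Q = 2" using Q by (auto simp: convex_polygon_def)
  let ?E = "{e. e edge_of Q}"
  define \<H> where "\<H> = (\<lambda>(i, j) (P :: (real^2)^'n). norm (P $ i - P $ j) / 2) ` {(i, j). i \<noteq> j}
     \<union> (\<lambda>(i, e) P. infdist (P $ i) e) ` (UNIV \<times> ?E)"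
  have edge: "convex e" "closed e" "e \<noteq> {}" if "e edge_of Q" for e
  proof -
    have "e face_of Q" "aff_dim e = 1" using that by (auto simp: edge_of_def)
    then show "convex e" "closed e" "e \<noteq> {}"
      using face_of_imp_convex face_of_imp_closed[of Q e] pQ
      by (auto simp: polytope_imp_convex polytope_imp_closed)
  qed
  have "finite ?E"
    using finite_polytope_faces[OF pQ(1)] by (rule rev_finite_subset) (auto simp: edge_of_def)
  then have "finite \<H>" unfolding \<H>_def by (intro finite_UnI finite_imageI finite_cartesian_product) auto
  \<comment> \<open>The facets of a two-dimensional polytope are edges; hence the minimum is over a
    nonempty set even for one generator.\<close>
  moreover obtain e where "e edge_of Q"
    using polytope_facet_exists[OF pQ(1)] pQ(2) by (auto simp: edge_of_def facet_of_def)
  then have "\<H> \<noteq> {}" unfolding \<H>_def by auto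
  moreover have "\<exists>z. norm z \<le> 1 \<and> (\<forall>y. h x + z \<bullet> (y - x) \<le> h y)" if "h \<in> \<H>" for h x
  proof -
    from that consider i j where "h = (\<lambda>P. norm (P $ i - P $ j) / 2)" "i \<noteq> j"
      | i e where "h = (\<lambda>P. infdist (P $ i) e)" "e edge_of Q"
      unfolding \<H>_def by auto
    then show ?thesis
    proof cases
      case (1 i j)
      \<comment> \<open>The factor 1/2 of the pairwise distance gives both blocks norm at most 1/2,
        so the constant 1 suffices here as for the edge distances.\<close>
      define u where "u = (1 / 2) *\<^sub>R sgn (x $ i - x $ j)"
      have nu: "norm u \<le> 1 / 2" by (simp add: u_def norm_sgn)
      have "norm (axis i u - axis j u) \<le> norm (axis i u) + norm (axis j u)" by (rule norm_triangle_ineq4)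
      then have "norm (axis i u - axis j u) \<le> 1" using nu by (simp add: norm_axis)
      moreover have "h x + (axis i u - axis j u) \<bullet> (y - x) \<le> h y" for y
        using norm_subgradient[of "x $ i - x $ j" "y $ i - y $ j"]
        by (simp add: 1 u_def inner_diff_left inner_diff_right inner_axis' )
      ultimately show ?thesis by blast
    next
      case (2 i e)
      obtain u where u: "norm u \<le> 1" "\<And>y. infdist (x $ i) e + u \<bullet> (y - x $ i) \<le> infdist y e"
        using infdist_subgradient[OF edge[OF 2(2)]] by blast
      have "h x + axis i u \<bullet> (y - x) \<le> h y" for y
        using u(2)[of "y $ i"] by (simp add: 2 inner_axis')
      then show ?thesis using u(1) by (intro exI[of _ "axis i u"]) (simp add: norm_axis)
    qed
  qed
  moreover have "H_SP Q x = Min ((\<lambda>h. h x) ` \<H>)" for x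
  proof -
    have "{norm (x $ i - x $ j) / 2 | i j. i \<noteq> j} \<union> {infdist (x $ i) e | i e. e edge_of Q} = (\<lambda>h. h x) ` \<H>"
    proof -
      have "{norm (x $ i - x $ j) / 2 | i j. i \<noteq> j} = (\<lambda>p. norm (x $ fst p - x $ snd p) / 2) ` {(i, j). i \<noteq> j}"
        unfolding image_def by (simp only: Bex_def split_paired_Ex mem_Collect_eq case_prod_conv fst_conv snd_conv) metis
      moreover have "{infdist (x $ i) e | i e. e edge_of Q} = (\<lambda>p. infdist (x $ fst p) (snd p)) ` (UNIV \<times> ?E)"
        unfolding image_def by (simp only: Bex_def split_paired_Ex mem_Collect_eq mem_Sigma_iff UNIV_I fst_conv snd_conv) metis
      ultimately show ?thesis
        by (simp add: \<H>_def image_Un image_image case_prod_beta')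
    qed
    then show ?thesis unfolding H_SP_def by simp
  qed
  ultimately show ?thesis
    using pQ by (intro subgradient_cover_Min[where \<H> = \<H>] compact_configurations convex_configurations)
      (auto simp: polytope_imp_compact polytope_imp_convex)
qed

section \<open>The disk-covering function\<close>

text \<open>A theorem of the alternative of Gordan type. If the hull of the \<open>n i\<close>
  missed the orthogonal complement of \<open>W\<close>, a separating functional \<open>a\<close>
  would be bounded below on that subspace, hence vanish there; then \<open>a\<close> lies in
  \<open>W\<close>, and \<open>- a\<close> has positive product with every
  \<open>n i\<close>.\<close>

lemma positive_or_orthogonal_combination:
  fixes n :: "'i \<Rightarrow> 'b::euclidean_space"
  assumes I: "finite I" "I \<noteq> {}" and W: "subspace W"
    and no_pos: "\<And>w. w \<in> W \<Longrightarrow> \<exists>i\<in>I. n i \<bullet> w \<le> 0"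
  shows "\<exists>J \<mu>. J \<subseteq> I \<and> (\<forall>i\<in>J. 0 \<le> \<mu> i) \<and> sum \<mu> J = 1 \<and> (\<forall>w\<in>W. (\<Sum>i\<in>J. \<mu> i *\<^sub>R n i) \<bullet> w = 0)"
proof -
  have "convex hull (n ` I) \<inter> W\<^sup>\<bottom> \<noteq> {}"
  proof
    assume "convex hull (n ` I) \<inter> W\<^sup>\<bottom> = {}"
    moreover have "compact (convex hull (n ` I))"
      using I by (intro compact_convex_hull finite_imp_compact) auto
    moreover have "closed (W\<^sup>\<bottom>)" "convex (W\<^sup>\<bottom>)"
      using subspace_orthogonal_comp by (auto intro: closed_subspace subspace_imp_convex)
    moreover have "convex hull (n ` I) \<noteq> {}" using I by simp
    ultimately obtain a b where ab: "\<And>x. x \<in> convex hull (n ` I) \<Longrightarrow> a \<bullet> x < b"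
        "\<And>x. x \<in> W\<^sup>\<bottom> \<Longrightarrow> b < a \<bullet> x"
      using separating_hyperplane_compact_closed[OF convex_convex_hull] by metis
    have b: "b < 0" using ab(2)[of 0] subspace_0[OF subspace_orthogonal_comp[of W]] by simp
    have "a \<bullet> y = 0" if y: "y \<in> W\<^sup>\<bottom>" for y
    proof (rule ccontr)
      assume "a \<bullet> y \<noteq> 0"
      moreover have "(b / (a \<bullet> y)) *\<^sub>R y \<in> W\<^sup>\<bottom>"
        using y subspace_orthogonal_comp subspace_scale by blast
      ultimately show False using ab(2)[of "(b / (a \<bullet> y)) *\<^sub>R y"] by simp
    qed
    then have "a \<in> W\<^sup>\<bottom>\<^sup>\<bottom>" by (simp add: orthogonal_comp_def orthogonal_def inner_commute)
    then have "a \<in> W" by (simp add: orthogonal_comp_self W)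
    then have "- a \<in> W" using W subspace_neg by blast
    then obtain i where "i \<in> I" "n i \<bullet> (- a) \<le> 0" using no_pos by blast
    moreover have "a \<bullet> n i < b" using ab(1) \<open>i \<in> I\<close> by (simp add: hull_inc)
    ultimately show False using b by (simp add: inner_commute)
  qed
  then obtain x where x: "x \<in> convex hull (n ` I)" "x \<in> W\<^sup>\<bottom>" by blast
  \<comment> \<open>The hull assigns weights to vectors and \<open>n\<close> may repeat values, so
    one index is kept for each value.\<close>
  obtain J where J: "J \<subseteq> I" "inj_on n J" "n ` I = n ` J"
    by (metis subset_image_inj order_refl)
  obtain u where u: "\<forall>y\<in>n ` J. 0 \<le> u y" "sum u (n ` J) = 1" "(\<Sum>y\<in>n ` J. u y *\<^sub>R y) = x"
    using x(1) I J unfolding convex_hull_finite[OF finite_imageI[OF I(1)]] by auto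
  have "(\<Sum>i\<in>J. (u \<circ> n) i *\<^sub>R n i) = x" "sum (u \<circ> n) J = 1"
    using u(2,3) J(2) by (simp_all add: sum.reindex)
  then show ?thesis
    using J(1) u(1) x(2) by (intro exI[of _ J] exI[of _ "u \<circ> n"])
      (auto simp: orthogonal_comp_def orthogonal_def inner_commute)
qed

text \<open>A face of least dimension containing \<open>q\<close> works: in its relative frontier,
  \<open>q\<close> would lie on a facet of smaller dimension.\<close>

lemma polytope_minimal_face:
  fixes Q :: "'a::euclidean_space set"
  assumes Q: "polytope Q" and q: "q \<in> Q"
  obtains F where "F face_of Q" "q \<in> rel_interior F"
proof -
  let ?\<F> = "{F. F face_of Q \<and> q \<in> F}"
  have fin: "finite ?\<F>" using finite_polytope_faces[OF Q] by (rule rev_finite_subset) auto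
  have "Q \<in> ?\<F>" using q Q by (simp add: face_of_refl polytope_imp_convex)
  then obtain F where "is_arg_min aff_dim (\<lambda>G. G \<in> ?\<F>) F"
    using ex_is_arg_min_if_finite[OF fin] by blast
  then have F: "F \<in> ?\<F>" "\<And>G. G \<in> ?\<F> \<Longrightarrow> aff_dim F \<le> aff_dim G"
    by (auto simp: is_arg_min_linorder)
  have "polytope F" using F(1) Q face_of_polytope_polytope by blast
  have "q \<in> rel_interior F"
  proof (rule ccontr)
    assume "q \<notin> rel_interior F"
    then have "q \<in> rel_frontier F"
      using F(1) closure_subset by (auto simp: rel_frontier_def)
    then obtain G where G: "G facet_of F" "q \<in> G"
      using rel_frontier_of_polyhedron[OF polytope_imp_polyhedron[OF \<open>polytope F\<close>]] by auto
    then have "G \<in> ?\<F>" using F(1) face_of_trans by (auto simp: facet_of_def)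
    then show False using F(2)[of G] G(1) by (simp add: facet_of_def)
  qed
  then show thesis using that F(1) by blast
qed

lemma rel_interior_eventually:
  fixes F :: "'a::euclidean_space set"
  assumes q: "q \<in> rel_interior F" and w: "w \<in> span ((\<lambda>p. p - q) ` F)"
  shows "eventually (\<lambda>s. q + s *\<^sub>R w \<in> F) (at_right 0)"
proof -
  obtain e where e: "e > 0" "ball q e \<inter> affine hull F \<subseteq> F" and qF: "q \<in> F"
    using q by (auto simp: mem_rel_interior_ball)
  have "q + s *\<^sub>R w \<in> affine hull F" for s
    unfolding affine_hull_span_gen[OF hull_inc[OF qF]] using w span_scale by auto
  moreover have "((\<lambda>s. dist q (q + s *\<^sub>R w)) \<longlongrightarrow> dist q (q + 0 *\<^sub>R w)) (at_right 0)"
    by (intro tendsto_intros)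
  then have "eventually (\<lambda>s. dist q (q + s *\<^sub>R w) < e) (at_right 0)"
    using e(1) by (intro order_tendstoD) auto
  ultimately show ?thesis using e(2) by (auto elim!: eventually_mono)
qed

section \<open>Distance to the nearest generator and its maximum over the polygon\<close>

definition nearest_distance :: "real^2 \<Rightarrow> (real^2)^'n \<Rightarrow> real" where
  "nearest_distance q P = (MIN i. norm (q - P $ i))"

lemma nearest_distance_le: "nearest_distance q P \<le> norm (q - P $ i)"
  unfolding nearest_distance_def by simp

lemma nearest_distance_attained: "\<exists>i. nearest_distance q P = norm (q - P $ i)"
proof -
  have "nearest_distance q P \<in> range (\<lambda>i. norm (q - P $ i))"
    unfolding nearest_distance_def by (intro Min_in) auto
  then show ?thesis by blast
qed

lemma nearest_distance_diff: "nearest_distance q P \<le> nearest_distance p R + norm (q - p) + norm (P - R)"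
proof -
  obtain i where i: "nearest_distance p R = norm (p - R $ i)" using nearest_distance_attained by blast
  have "norm (q - P $ i) \<le> norm (p - R $ i) + norm (q - p) + norm (P $ i - R $ i)" by norm
  moreover have "norm (P $ i - R $ i) \<le> norm (P - R)" using Finite_Cartesian_Product.norm_nth_le[of "P - R" i] by simp
  ultimately show ?thesis using nearest_distance_le[of q P i] i by linarith
qed

context
  fixes Q :: "(real^2) set"
  assumes Q: "convex_polygon Q"
begin

lemma polygon_props: "polytope Q" "compact Q" "convex Q" "Q \<noteq> {}" "infinite Q"
proof -
  have pQ: "polytope Q" "aff_dim Q = 2" using Q by (auto simp: convex_polygon_def)
  show "polytope Q" "compact Q" "convex Q" "Q \<noteq> {}"
    using pQ by (auto simp: polytope_imp_compact polytope_imp_convex)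
  show "infinite Q"
    using pQ connected_finite_iff_sing[OF convex_connected[OF \<open>convex Q\<close>]] by auto
qed

lemma H_DC_attained: "\<exists>q\<in>Q. H_DC Q P = nearest_distance q P \<and> (\<forall>p\<in>Q. nearest_distance p P \<le> H_DC Q P)"
proof -
  have "1-lipschitz_on Q (\<lambda>q. nearest_distance q P)"
  proof (rule lipschitz_onI)
    fix x y
    show "dist (nearest_distance x P) (nearest_distance y P) \<le> 1 * dist x y"
      using nearest_distance_diff[of x P y P] nearest_distance_diff[of y P x P]
      by (simp add: dist_norm abs_le_iff norm_minus_commute)
  qed simp
  then have "continuous_on Q (\<lambda>q. nearest_distance q P)" by (rule lipschitz_on_continuous_on)
  then obtain q where q: "q \<in> Q" "\<And>p. p \<in> Q \<Longrightarrow> nearest_distance p P \<le> nearest_distance q P"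
    using continuous_attains_sup[OF polygon_props(2,4)] by blast
  have "H_DC Q P = (SUP q\<in>Q. nearest_distance q P)" by (simp add: H_DC_def nearest_distance_def)
  also have "\<dots> = nearest_distance q P"
    using q by (intro cSup_eq_maximum) auto
  finally show ?thesis using q by auto
qed

lemma H_DC_ge: "q \<in> Q \<Longrightarrow> nearest_distance q P \<le> H_DC Q P"
  using H_DC_attained by blast

text \<open>Finitely many generators cannot exhaust the infinite set \<open>Q\<close>. Positivity
  permits the normalization of the vectors \<open>n i\<close> below.\<close>

lemma H_DC_pos: "0 < H_DC Q (P :: (real^2)^'n)"
proof -
  obtain q where q: "q \<in> Q" "q \<notin> range (\<lambda>i. P $ i)"
    using polygon_props(5) finite_subset[of Q "range (\<lambda>i. P $ i)"] by auto
  obtain i where "nearest_distance q P = norm (q - P $ i)" using nearest_distance_attained by blast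
  moreover have "0 < norm (q - P $ i)" using q(2) by auto
  ultimately show ?thesis using H_DC_ge[OF q(1), of P] by linarith
qed

lemma H_DC_lipschitz: "1-lipschitz_on UNIV (H_DC Q :: (real^2)^'n \<Rightarrow> real)"
proof -
  have *: "H_DC Q P \<le> H_DC Q R + norm (P - R)" for P R :: "(real^2)^'n"
  proof -
    obtain q where "q \<in> Q" "H_DC Q P = nearest_distance q P" using H_DC_attained by blast
    then show ?thesis using nearest_distance_diff[of q P q R] H_DC_ge[of q R] by simp
  qed
  show ?thesis
    using * by (intro lipschitz_onI) (auto simp: dist_norm abs_le_iff diff_le_eq add.commute, metis norm_minus_commute)
qed

text \<open>The configurations for which some \<open>q \<in> F\<close> is equidistant to the generators in \<open>J\<close>, at the
  distance \<open>H_DC\<close>. Choosing \<open>F\<close> as the face with a maximizer \<open>q\<close> in its relative interior, the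
  multipliers in the optimality condition for \<open>q\<close> yield a subgradient of \<open>H_DC\<close> on the stratum.\<close>

definition stratum :: "'n set \<Rightarrow> (real^2) set \<Rightarrow> ((real^2)^'n) set" where
  "stratum J F = {P \<in> configurations Q. \<exists>q\<in>F. \<forall>i\<in>J. norm (q - P $ i) = H_DC Q P}"

text \<open>The existential quantifier over \<open>q\<close> is a projection along the compact face.
  This is why \<open>q\<close> ranges over the whole face in \<open>stratum\<close> and not only
  over its relative interior.\<close>

lemma compact_stratum:
  assumes "F face_of Q"
  shows "compact (stratum J F :: ((real^2)^'n) set)"
proof -
  have cF: "compact F" using assms polygon_props face_of_imp_compact by blast
  have "closed {p :: (real^2) \<times> ((real^2)^'n). norm (fst p - snd p $ i) = H_DC Q (snd p)}" for i
    by (intro closed_Collect_eq continuous_intros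
        continuous_on_compose2[OF lipschitz_on_continuous_on[OF H_DC_lipschitz]]) auto
  moreover define K where "K = F \<times> configurations Q \<inter> (\<Inter>i\<in>J. {p :: (real^2) \<times> ((real^2)^'n). norm (fst p - snd p $ i) = H_DC Q (snd p)})"
  ultimately have "compact K"
    unfolding K_def using polygon_props
    by (intro compact_Int_closed compact_Times cF compact_configurations closed_INT) auto
  then have "compact (snd ` K)" by (intro compact_continuous_image continuous_intros)
  moreover have "P \<in> snd ` K \<longleftrightarrow> P \<in> stratum J F" for P
  proof
    assume "P \<in> stratum J F"
    then obtain q where "(q, P) \<in> K" by (auto simp: K_def stratum_def)
    then show "P \<in> snd ` K" by force
  qed (auto simp: K_def stratum_def)
  then have "snd ` K = stratum J F" by blast
  ultimately show ?thesis by simp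
qed

section \<open>Optimality conditions at a maximizer \<open>q\<close> in the relative interior of a
  face\<close>

context
  fixes P :: "(real^2)^'n" and q :: "real^2" and F :: "(real^2) set" and r :: real and I :: "'n set"
    and n :: "'n \<Rightarrow> real^2" and W :: "(real^2) set"
  assumes P: "P \<in> configurations Q" and q: "H_DC Q P = nearest_distance q P"
    and F: "F face_of Q" "q \<in> rel_interior F"
  defines "r \<equiv> H_DC Q P"
  defines "I \<equiv> {i. norm (q - P $ i) = r}"
  defines "n \<equiv> \<lambda>i. (q - P $ i) /\<^sub>R r"
  defines "W \<equiv> span ((\<lambda>p. p - q) ` F)"
begin

lemma r_pos: "r > 0" unfolding r_def by (rule H_DC_pos)

lemma active_nonempty: "I \<noteq> {}"
  using nearest_distance_attained[of q P] q by (auto simp: I_def r_def)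

lemma n_props: "i \<in> I \<Longrightarrow> norm (n i) = 1" "n i \<bullet> (q - P $ i) = norm (q - P $ i) * norm (n i)"
  using r_pos by (auto simp: I_def n_def power2_norm_eq_inner[symmetric] power2_eq_square)

lemma active_lower_bound: "i \<in> I \<Longrightarrow> r + n i \<bullet> (w - h) \<le> norm (q + w - (P $ i + h))"
proof -
  assume i: "i \<in> I"
  have "n i \<bullet> (q + w - (P $ i + h)) \<le> norm (n i) * norm (q + w - (P $ i + h))"
    by (rule norm_cauchy_schwarz)
  moreover have "n i \<bullet> (q + w - (P $ i + h)) = n i \<bullet> (q - P $ i) + n i \<bullet> (w - h)"
    by (simp add: inner_diff_right inner_add_right)
  moreover have "n i \<bullet> (q - P $ i) = r" using n_props[of i] i by (simp add: I_def)
  ultimately show ?thesis using n_props(1)[OF i] by simp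
qed

text \<open>The moved point \<open>q + s *\<^sub>R w\<close> serves as a competitor in the supremum:
  its active distances grow at rate at least \<open>c\<close> by convexity of the norm, while the
  inactive ones exceed \<open>r\<close> strictly and stay larger for small \<open>s\<close>.\<close>

lemma first_order_lower_bound:
  assumes w: "w \<in> W" and c: "\<And>i. i \<in> I \<Longrightarrow> c \<le> n i \<bullet> (w - h $ i)"
  shows "eventually (\<lambda>s. H_DC Q P + s * c \<le> H_DC Q (P + s *\<^sub>R h)) (at_right 0)"
proof -
  have "eventually (\<lambda>s. r + s * c \<le> norm (q + s *\<^sub>R w - (P + s *\<^sub>R h) $ i)) (at_right 0)" for i
  proof (cases "i \<in> I")
    case True
    have "r + s * c \<le> norm (q + s *\<^sub>R w - (P + s *\<^sub>R h) $ i)" if "s > 0" for s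
    proof -
      have "s * c \<le> s * (n i \<bullet> (w - h $ i))" using c[OF True] that by simp
      then show ?thesis
        using active_lower_bound[OF True, of "s *\<^sub>R w" "s *\<^sub>R h $ i"]
        by (simp add: scaleR_diff_right[symmetric])
    qed
    then show ?thesis by (intro eventually_mono[OF eventually_at_right_less]) auto
  next
    case False
    then have "r < norm (q - P $ i)"
      using nearest_distance_le[of q P i] q by (auto simp: I_def r_def)
    moreover have "((\<lambda>s. norm (q + s *\<^sub>R w - (P + s *\<^sub>R h) $ i) - (r + s * c)) \<longlongrightarrow>
        norm (q + 0 *\<^sub>R w - (P + 0 *\<^sub>R h) $ i) - (r + 0 * c)) (at_right 0)"
      by (intro tendsto_intros)
    ultimately have "eventually (\<lambda>s. 0 < norm (q + s *\<^sub>R w - (P + s *\<^sub>R h) $ i) - (r + s * c)) (at_right 0)"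
      by (intro order_tendstoD) auto
    then show ?thesis by (rule eventually_mono) simp
  qed
  then have "eventually (\<lambda>s. \<forall>i. r + s * c \<le> norm (q + s *\<^sub>R w - (P + s *\<^sub>R h) $ i)) (at_right 0)"
    by (rule eventually_all_finite)
  then show ?thesis
    using rel_interior_eventually[OF F(2) w[unfolded W_def]]
  proof eventually_elim
    case (elim s)
    then have "q + s *\<^sub>R w \<in> Q" using F(1) face_of_imp_subset by blast
    moreover have "r + s * c \<le> nearest_distance (q + s *\<^sub>R w) (P + s *\<^sub>R h)"
      using nearest_distance_attained[of "q + s *\<^sub>R w" "P + s *\<^sub>R h"] elim(1) by metis
    ultimately show ?case using H_DC_ge[of "q + s *\<^sub>R w" "P + s *\<^sub>R h"] by (simp add: r_def)
  qed
qed

text \<open>For \<open>R\<close> in the stratum with witness \<open>p\<close>, all distances indexed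
  by \<open>J\<close> equal \<open>H_DC Q R\<close>, so the norm inequalities may be averaged with
  the weights \<open>\<mu>\<close>. The displacement \<open>p - q\<close> lies in \<open>W\<close>
  and drops out by orthogonality.\<close>

lemma stratum_subgradient:
  assumes J: "J \<subseteq> I" and nonneg: "\<And>i. i \<in> J \<Longrightarrow> 0 \<le> \<mu> i" and one: "sum \<mu> J = 1"
    and orth: "\<And>w. w \<in> W \<Longrightarrow> (\<Sum>i\<in>J. \<mu> i *\<^sub>R n i) \<bullet> w = 0"
  shows "P \<in> stratum J F" "norm (- (\<Sum>i\<in>J. \<mu> i *\<^sub>R axis i (n i))) \<le> 1"
    "R \<in> stratum J F \<Longrightarrow> H_DC Q P + - (\<Sum>i\<in>J. \<mu> i *\<^sub>R axis i (n i)) \<bullet> (R - P) \<le> H_DC Q R"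
proof -
  have qF: "q \<in> F" using F(2) rel_interior_subset by blast
  then show "P \<in> stratum J F" using P J by (auto simp: stratum_def I_def r_def)
  have "norm (\<Sum>i\<in>J. \<mu> i *\<^sub>R axis i (n i)) \<le> (\<Sum>i\<in>J. norm (\<mu> i *\<^sub>R axis i (n i)))" by (rule norm_sum)
  also have "\<dots> = (\<Sum>i\<in>J. \<mu> i)"
    using J nonneg n_props(1) by (intro sum.cong) (auto simp: norm_axis)
  finally show "norm (- (\<Sum>i\<in>J. \<mu> i *\<^sub>R axis i (n i))) \<le> 1" using one by simp
  assume "R \<in> stratum J F"
  then obtain p where p: "p \<in> F" "\<And>i. i \<in> J \<Longrightarrow> norm (p - R $ i) = H_DC Q R"
    by (auto simp: stratum_def)
  have "(\<Sum>i\<in>J. \<mu> i * (r + n i \<bullet> ((p - q) - (R $ i - P $ i)))) \<le> (\<Sum>i\<in>J. \<mu> i * H_DC Q R)"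
  proof (intro sum_mono mult_left_mono nonneg)
    fix i assume i: "i \<in> J"
    have "r + n i \<bullet> ((p - q) - (R $ i - P $ i)) \<le> norm (q + (p - q) - (P $ i + (R $ i - P $ i)))"
      using i J by (intro active_lower_bound) auto
    then show "r + n i \<bullet> ((p - q) - (R $ i - P $ i)) \<le> H_DC Q R" using p(2)[OF i] by simp
  qed
  also have "\<dots> = H_DC Q R" using one by (simp add: sum_distrib_right[symmetric])
  also have "(\<Sum>i\<in>J. \<mu> i * (r + n i \<bullet> ((p - q) - (R $ i - P $ i))))
      = r * sum \<mu> J + (\<Sum>i\<in>J. \<mu> i *\<^sub>R n i) \<bullet> (p - q) - (\<Sum>i\<in>J. \<mu> i *\<^sub>R axis i (n i)) \<bullet> (R - P)"
    by (simp add: inner_sum_left inner_axis' sum_distrib_left sum.distrib[symmetric]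
        sum_subtractf[symmetric] inner_diff_right algebra_simps)
  also have "(\<Sum>i\<in>J. \<mu> i *\<^sub>R n i) \<bullet> (p - q) = 0"
    using p(1) by (intro orth) (auto simp: W_def intro: span_base)
  finally show "H_DC Q P + - (\<Sum>i\<in>J. \<mu> i *\<^sub>R axis i (n i)) \<bullet> (R - P) \<le> H_DC Q R"
    using one by (simp add: r_def)
qed

text \<open>A direction in \<open>W\<close> increasing all active distances would allow a point of
  \<open>Q\<close> better than the maximizer \<open>q\<close>; the alternative then supplies the
  multipliers.\<close>

lemma H_DC_subgradient_exists:
  "\<exists>J. P \<in> stratum J F \<and> (\<exists>z. norm z \<le> 1 \<and> (\<forall>R\<in>stratum J F. H_DC Q P + z \<bullet> (R - P) \<le> H_DC Q R))"
proof -
  have "\<exists>i\<in>I. n i \<bullet> w \<le> 0" if w: "w \<in> W" for w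
  proof (rule ccontr)
    assume "\<not> ?thesis"
    then have pos: "n i \<bullet> w > 0" if "i \<in> I" for i using that by (auto simp: not_le)
    define c where "c = (MIN i\<in>I. n i \<bullet> w)"
    have "c > 0" using pos active_nonempty by (auto simp: c_def)
    have "eventually (\<lambda>s. H_DC Q P + s * c \<le> H_DC Q (P + s *\<^sub>R 0)) (at_right 0)"
      using w by (rule first_order_lower_bound) (simp add: c_def)
    then have "eventually (\<lambda>s. s * c \<le> 0) (at_right 0)" by simp
    then have "eventually (\<lambda>s::real. False) (at_right 0)"
      using eventually_at_right_less[of 0] by eventually_elim (use \<open>c > 0\<close> in \<open>simp add: mult_le_0_iff\<close>)
    then show False by simp
  qed
  then obtain J \<mu> where "J \<subseteq> I" "\<forall>i\<in>J. 0 \<le> \<mu> i" "sum \<mu> J = 1"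
      "\<forall>w\<in>W. (\<Sum>i\<in>J. \<mu> i *\<^sub>R n i) \<bullet> w = 0"
    using positive_or_orthogonal_combination[of I W n] active_nonempty
    unfolding W_def by (auto simp: subspace_span)
  then show ?thesis using stratum_subgradient[of J \<mu>] by blast
qed

text \<open>The same alternative for joint moves \<open>w\<close> of the maximizer and
  \<open>h\<close> of the generators: not all active rates can exceed the directional derivative
  \<open>g \<bullet> h\<close>. As \<open>h\<close> is unrestricted, orthogonality forces
  \<open>g\<close> to equal the subgradient built from the multipliers.\<close>

lemma H_DC_gradient_subgradient:
  assumes g: "GDERIV (H_DC Q) P :> g"
  shows "\<exists>J. P \<in> stratum J F \<and> (\<forall>R\<in>stratum J F. H_DC Q P + g \<bullet> (R - P) \<le> H_DC Q R)"
proof -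
  \<comment> \<open>\<open>m i\<close> represents the rate of the active distance \<open>i\<close>
    minus the rate of \<open>H_DC\<close> as a linear form in the pair
    \<open>(w, h)\<close>.\<close>
  define m where "m i = (n i, - axis i (n i) - g)" for i
  have m: "m i \<bullet> (w, h) = n i \<bullet> (w - h $ i) - g \<bullet> h" for i w h
    by (simp add: m_def inner_diff_left inner_diff_right inner_axis')
  have "\<exists>i\<in>I. m i \<bullet> p \<le> 0" if "p \<in> W \<times> UNIV" for p
  proof (rule ccontr)
    assume neg: "\<not> ?thesis"
    obtain w h where p: "p = (w, h)" "w \<in> W" using \<open>p \<in> W \<times> UNIV\<close> by auto
    define c where "c = (MIN i\<in>I. m i \<bullet> p)"
    have "c > 0" using neg active_nonempty by (auto simp: c_def not_le)
    have "c \<le> m i \<bullet> p" if "i \<in> I" for i using that by (simp add: c_def)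
    then have "g \<bullet> h + c \<le> n i \<bullet> (w - h $ i)" if "i \<in> I" for i
      using that m[of i w h] p(1) by (metis add.commute le_diff_eq)
    then have "eventually (\<lambda>s. H_DC Q P + s * (g \<bullet> h + c) \<le> H_DC Q (P + s *\<^sub>R h)) (at_right 0)"
      by (rule first_order_lower_bound[OF p(2)])
    then have "eventually (\<lambda>s. g \<bullet> h + c \<le> (H_DC Q (P + s *\<^sub>R h) - H_DC Q P) / s) (at_right 0)"
      using eventually_at_right_less[of 0] by eventually_elim (simp add: le_divide_eq mult.commute)
    then have "g \<bullet> h + c \<le> g \<bullet> h"
      by (intro tendsto_lowerbound[OF gradient_directional_tendsto[OF g]]) auto
    then show False using \<open>c > 0\<close> by simp
  qed
  moreover have "subspace (W \<times> (UNIV :: ((real^2)^'n) set))"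
    unfolding W_def by (intro subspace_Times subspace_span subspace_UNIV)
  ultimately obtain J \<mu> where J: "J \<subseteq> I" "\<forall>i\<in>J. 0 \<le> \<mu> i" "sum \<mu> J = 1"
      "\<forall>p\<in>W \<times> UNIV. (\<Sum>i\<in>J. \<mu> i *\<^sub>R m i) \<bullet> p = 0"
    using positive_or_orthogonal_combination[of I "W \<times> UNIV" m] active_nonempty by auto
  have "(\<Sum>i\<in>J. \<mu> i *\<^sub>R m i) = (\<Sum>i\<in>J. \<mu> i *\<^sub>R n i, (\<Sum>i\<in>J. \<mu> i *\<^sub>R (- axis i (n i) - g)))"
    by (simp add: m_def prod_eq_iff fst_sum snd_sum)
  also have "(\<Sum>i\<in>J. \<mu> i *\<^sub>R (- axis i (n i) - g)) = - (\<Sum>i\<in>J. \<mu> i *\<^sub>R axis i (n i)) - g"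
    using J(3) by (simp add: scaleR_diff_right sum_subtractf sum_negf scaleR_sum_left[symmetric])
  finally have eq: "(\<Sum>i\<in>J. \<mu> i *\<^sub>R m i) = (\<Sum>i\<in>J. \<mu> i *\<^sub>R n i, - (\<Sum>i\<in>J. \<mu> i *\<^sub>R axis i (n i)) - g)" .
  have "(\<Sum>i\<in>J. \<mu> i *\<^sub>R n i) \<bullet> w = 0" if "w \<in> W" for w
    using J(4)[rule_format, of "(w, 0)"] that unfolding eq by simp
  moreover have "0 \<in> W" by (simp add: W_def span_zero)
  then have "(- (\<Sum>i\<in>J. \<mu> i *\<^sub>R axis i (n i)) - g) \<bullet> h = 0" for h
    using J(4)[rule_format, of "(0, h)"] unfolding eq by simp
  from this[of "- (\<Sum>i\<in>J. \<mu> i *\<^sub>R axis i (n i)) - g"]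
  have "- (\<Sum>i\<in>J. \<mu> i *\<^sub>R axis i (n i)) - g = 0" by (simp only: inner_eq_zero_iff)
  then have "g = - (\<Sum>i\<in>J. \<mu> i *\<^sub>R axis i (n i))" by (simp only: right_minus_eq)
  ultimately show ?thesis using stratum_subgradient[of J \<mu>] J by blast
qed

end

lemma H_DC_subgradient_cover:
  "\<exists>\<G>. subgradient_cover (configurations Q) (H_DC Q :: (real^2)^'n \<Rightarrow> real) 1 \<G>"
proof -
  let ?D = "configurations Q :: ((real^2)^'n) set"
  let ?\<A> = "(\<lambda>(J, F). stratum J F :: ((real^2)^'n) set) ` (UNIV \<times> {F. F face_of Q})"
  have face: "\<exists>q F. H_DC Q P = nearest_distance q P \<and> F face_of Q \<and> q \<in> rel_interior F" for P :: "(real^2)^'n"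
    using H_DC_attained[of P] polytope_minimal_face[OF polygon_props(1)] by metis
  have "subgradient_cover ?D (H_DC Q) 1 (subgradient_graph (H_DC Q) 1 ` ?\<A>)"
  proof (rule subgradient_coverI[OF _ _ H_DC_lipschitz])
    show "compact ?D" "convex ?D"
      using polygon_props by (auto intro: compact_configurations convex_configurations)
    show "finite ?\<A>" using finite_polytope_faces[OF polygon_props(1)] by simp
    show "compact A" if "A \<in> ?\<A>" for A using that compact_stratum by auto
    show "\<exists>A\<in>?\<A>. P \<in> A \<and> (\<exists>z. norm z \<le> 1 \<and> (\<forall>R\<in>A. H_DC Q P + z \<bullet> (R - P) \<le> H_DC Q R))"
      if P: "P \<in> ?D" for P
    proof -
      obtain q F where qF: "H_DC Q P = nearest_distance q P" "F face_of Q" "q \<in> rel_interior F"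
        using face by blast
      then show ?thesis using H_DC_subgradient_exists[OF P qF] by blast
    qed
    show "\<exists>A\<in>?\<A>. P \<in> A \<and> (\<forall>R\<in>A. H_DC Q P + g \<bullet> (R - P) \<le> H_DC Q R)"
      if P: "P \<in> interior ?D" and g: "GDERIV (H_DC Q) P :> g" for P g
    proof -
      obtain q F where qF: "H_DC Q P = nearest_distance q P" "F face_of Q" "q \<in> rel_interior F"
        using face by blast
      moreover have "P \<in> ?D" using P interior_subset by blast
      ultimately show ?thesis using H_DC_gradient_subgradient[OF _ qF g] by blast
    qed
  qed
  then show ?thesis by blast
qed

end

section \<open>The convergence theorem\<close>

theorem proposition5p1:
  fixes Q :: "(real^2) set" and S :: "((real^2)^'n) set"
  assumes "convex_polygon Q" and "negligible S"
  shows "(\<forall>P :: real \<Rightarrow> (real^2)^'n.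
            P 0 \<in> configurations Q \<and>
            filippov_solution (configurations Q)
              (\<lambda>x. - least_norm (generalized_gradient S (configurations Q) (H_DC Q) x)) P \<longrightarrow>
            converges_to_set P (critical_points S (configurations Q) (H_DC Q))) \<and>
         (\<forall>P :: real \<Rightarrow> (real^2)^'n.
            P 0 \<in> configurations Q \<and>
            filippov_solution (configurations Q)
              (\<lambda>x. least_norm (generalized_gradient S (configurations Q) (H_SP Q) x)) P \<longrightarrow>
            converges_to_set P (critical_points S (configurations Q) (H_SP Q)))"
proof -
  obtain G where "subgradient_cover (configurations Q) (H_DC Q :: (real^2)^'n \<Rightarrow> real) 1 G"
    using H_DC_subgradient_cover[OF assms(1)] by blast
  then interpret DC: subgradient_cover "configurations Q" "H_DC Q :: (real^2)^'n \<Rightarrow> real" 1 G .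
  obtain G' where "subgradient_cover (configurations Q) (H_SP Q :: (real^2)^'n \<Rightarrow> real) 1 G'"
    using H_SP_subgradient_cover[OF assms(1)] by blast
  then interpret SP: subgradient_cover "configurations Q" "H_SP Q :: (real^2)^'n \<Rightarrow> real" 1 G' .
  show ?thesis
    using DC.solution_converges[OF assms(2), of "- 1"] SP.solution_converges[OF assms(2), of 1]
    by simp
qed

end
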